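(* Let $\Bbbk$ be a field, $N\ge 3$, and let $\mathrm{n}\widehat{\mathrm{TL}}_N$ be the affine nilTemperley-Lieb algebra with generators $a_0,\dots,a_{N-1}$ (indices modulo $N$). (1) Every nonzero monomial in the generators can be rewritten uniquely in the form $$(a^{(m)}_{i_1}\cdots a^{(m)}_{i_k})\cdots(a^{(n+1)}_{i_1}\cdots a^{(n+1)}_{i_k})(a^{(n)}_{i_1}\cdots a^{(n)}_{i_k})\cdots(a^{(1)}_{i_1}\cdots a^{(1)}_{i_k})(a_{i_1}\cdots a_{i_k})$$ with $a^{(n)}_{i_\ell}\in\{1,a_0,a_1,\dots,a_{N-1}\}$ for all $1\le n\le m$, $1\le \ell\le k$, such that (with $a^{(0)}_{i_\ell}:=a_{i_\ell}$), for all $0\le n<m$ and $1\le\ell\le k$, $$a^{(n+1)}_{i_\ell}\in\begin{cases}\{1\}&\text{if }a^{(n)}_{i_\ell}=1,\\ \{1,a_{j+1}\}&\text{if }a^{(n)}_{i_\ell}=a_j.\end{cases}$$ Here the factors $a_{i_1},\dots,a_{i_k}$ are determined by the property that the generator $a_{i_\ell-1}$ does not appear to the right of $a_{i_\ell}$ in the original presentation of the monomial (precisely: $\{i_1,\dots,i_k\}$ is the set of indices $i$ such that some occurrence of $a_i$ in the given word has no occurrence of $a_{i-1}$ to its right). The $i_1,\dots,i_k$ are listed in the order fixed in the context, and $m$ is chosen minimal, i.e. if $m\ge1$ then not all $a^{(m)}_{i_\ell}$ equal $1$. (2) Alternatively, every nonzero monomial is uniquely determined by the following data from its action on the representation $\mathsf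 V$ described in the context: the input particle configuration with the minimal number of particles on which it acts nontrivially (i.e. by a nonzero result), the output particle configuration, and the power of $q$ by which it acts. That is, for every nonzero monomial $a$ there is a unique $I\subseteq\{1,\dots,N\}$ of minimal cardinality with $a\,v(I)\neq 0$; one has $a\,v(I)=\pm q^{\ell}v(I')$ for some $I'$ and some $\ell\ge 0$; and two nonzero monomials with the same triple $(I,I',\ell)$ are equal in $\mathrm{n}\widehat{\mathrm{TL}}_N$.
   Context: The affine nilTemperley-Lieb algebra $\mathrm{n}\widehat{\mathrm{TL}}_N$ ($N\ge3$) is the unital associative $\Bbbk$-algebra with generators $a_0,\dots,a_{N-1}$ and relations $a_i^2=0$, $a_ia_j=a_ja_i$ for $i-j\not\equiv\pm1 \pmod N$, and $a_ia_{i+1}a_i=a_{i+1}a_ia_{i+1}=0$ for all $i$, all indices modulo $N$. A monomial is (the element represented by) a finite product $a_{j_1}\cdots a_{j_r}$ of generators; the empty product is $1$ (for it, $k=m=0$ and the expression is empty). Ordering convention: for a nonzero monomial $\ne1$, the set $S=\{i_1,\dots,i_k\}\subseteq\{0,\dots,N-1\}$ is a nonempty proper subset of $\mathbb Z/N\mathbb Z$. Let $\hat\imath$ be the largest element (in the usual order of $\{0,\dots,N-1\}$) with $\hat\imath\notin S$ and $\hat\imath-1\in S$ (indices modulo $N$). Then $i_1,\dots,i_k$ are listed so as to be increasing with respect to the order $\hat\imath\prec\hat\imath+1\prec\dots\prec\hat\imath+N-1$ on $\mathbb Z/N\mathbb Z$. Representation: let $v_1,\dots,v_N$ be a basis of $\Bbbk^N$,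 with $v_0:=v_N$, and $\mathsf V=\bigoplus_{k=0}^N\big(\Bbbk[q]\otimes_{\Bbbk}\bigwedge^k\Bbbk^N\big)$, a free $\Bbbk[q]$-module with basis $v(I)=v_{i_1}\wedge\dots\wedge v_{i_k}$ for $I=\{1\le i_1<\dots<i_k\le N\}$ ($v(\emptyset)$ is the basis element for $k=0$); $v(I)$ is viewed as a configuration of $k$ particles at positions $I$ on a circle with $N$ positions (positions $0$ and $N$ identified). The algebra acts $\Bbbk[q]$-linearly: for $1\le j\le N-1$, $a_jv(I)=v_{i_1}\wedge\dots\wedge v_{i_{\ell-1}}\wedge v_{j+1}\wedge v_{i_{\ell+1}}\wedge\dots\wedge v_{i_k}$ if $i_\ell=j$ for some $\ell$, and $a_jv(I)=0$ otherwise; $a_0v(I)=q\cdot v_{i_1}\wedge\dots\wedge v_{i_{k-1}}\wedge v_1$ if $i_k=N$, and $a_0v(I)=0$ otherwise. *)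

theory Defs
  imports
    "HOL-Library.Poly_Mapping"
    "HOL-Computational_Algebra.Polynomial"
    "HOL-Algebra.QuotRing"
    "HOL-Number_Theory.Cong"
begin

section \<open>The affine nilTemperley-Lieb algebra\<close>

text \<open>
  Words in the letters \<open>0, 1, 2, \<dots>\<close>, as a monoid under concatenation. The wrapper around lists
  avoids a global \<open>monoid_add\<close> instance for lists.
\<close>

datatype fword = Word (letters: "nat list")

instantiation fword :: monoid_add
begin

definition zero_fword :: fword where
  "0 = Word []"

definition plus_fword :: "fword \<Rightarrow> fword \<Rightarrow> fword" where
  "u + v = Word (letters u @ letters v)"

instance
  by standard (simp_all add: zero_fword_def plus_fword_def)

end

text \<open>
  The monoid algebra of words (with convolution as multiplication) is the free associative algebra;
  we restrict to the letters \<open>0, \<dots>, N - 1\<close>.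
\<close>

definition free_algebra :: "nat \<Rightarrow> (fword \<Rightarrow>\<^sub>0 'k::field) ring" where
  "free_algebra N =
     \<lparr>carrier = {p. \<forall>w \<in> Poly_Mapping.keys p. set (letters w) \<subseteq> {..<N}},
      mult = (*), one = 1, zero = 0, add = (+)\<rparr>"

definition letter :: "nat \<Rightarrow> fword \<Rightarrow>\<^sub>0 'k::field" where
  "letter i = Poly_Mapping.single (Word [i]) 1"

definition nTL_relators :: "nat \<Rightarrow> (fword \<Rightarrow>\<^sub>0 'k::field) set" where
  "nTL_relators N =
     {letter i * letter i | i. i < N}
   \<union> {letter i * letter j - letter j * letter i | i j. i < N \<and> j < N \<and>
        \<not> [int i - int j = 1] (mod int N) \<and> \<not> [int i - int j = - 1] (mod int N)}
   \<union> {letter i * letter (Suc i mod N) * letter i | i. i < N}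
   \<union> {letter (Suc i mod N) * letter i * letter (Suc i mod N) | i. i < N}"

text \<open>
  Ideals in HOL-Algebra are two-sided, and closed under scalars here because the scalars are the
  multiples of the empty word.
\<close>

definition nTL_ideal :: "nat \<Rightarrow> (fword \<Rightarrow>\<^sub>0 'k::field) set" where
  "nTL_ideal N = Idl\<^bsub>free_algebra N\<^esub> (nTL_relators N)"

type_synonym 'k nTL_elt = "(fword \<Rightarrow>\<^sub>0 'k) set"

definition nTL :: "nat \<Rightarrow> 'k::field nTL_elt ring" where
  "nTL N = free_algebra N Quot (nTL_ideal N)"

definition gen :: "nat \<Rightarrow> nat \<Rightarrow> 'k::field nTL_elt" where
  "gen N i = nTL_ideal N +>\<^bsub>free_algebra N\<^esub> letter i"

definition list_product :: "('a, 'b) monoid_scheme \<Rightarrow> 'a list \<Rightarrow> 'a" where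
  "list_product R xs = foldr (\<lambda>x y. x \<otimes>\<^bsub>R\<^esub> y) xs \<one>\<^bsub>R\<^esub>"

definition monomial_of :: "nat \<Rightarrow> nat list \<Rightarrow> 'k::field nTL_elt" where
  "monomial_of N ws = list_product (nTL N) (map (gen N) ws)"

definition nonzero_monomials :: "nat \<Rightarrow> 'k::field nTL_elt set" where
  "nonzero_monomials N = {monomial_of N ws | ws. set ws \<subseteq> {..<N}} - {\<zero>\<^bsub>nTL N\<^esub>}"


section \<open>The normal form\<close>

text \<open>
  The indices \<open>i\<close> such that some occurrence of \<open>a\<^sub>i\<close> in the word has no occurrence of
  \<open>a\<close> with index \<open>i - 1\<close> (modulo \<open>N\<close>) to its right.
\<close>

definition first_indices :: "nat \<Rightarrow> nat list \<Rightarrow> nat set" where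
  "first_indices N ws =
     {ws ! p | p. p < length ws \<and>
        (\<forall>r. p < r \<and> r < length ws \<longrightarrow> ws ! r \<noteq> (ws ! p + N - 1) mod N)}"

definition cyclic_start :: "nat \<Rightarrow> nat set \<Rightarrow> nat" where
  "cyclic_start N S = Max {i. i < N \<and> i \<notin> S \<and> (i + N - 1) mod N \<in> S}"

text \<open>
  The elements of \<open>S\<close>, increasing for the order starting at \<^term>\<open>cyclic_start N S\<close>. For empty \<open>S\<close>
  the start is unspecified, but the list is \<open>[]\<close> anyway.
\<close>

definition cyclic_listing :: "nat \<Rightarrow> nat set \<Rightarrow> nat list" where
  "cyclic_listing N S =
     filter (\<lambda>i. i \<in> S) (map (\<lambda>t. (cyclic_start N S + t) mod N) [0..<N])"

text \<open>
  A candidate normal form consists of the list \<open>js\<close> of the indices \<open>i\<^sub>1, \<dots>, i\<^sub>k\<close> and the list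
  \<open>A\<close> of the rows \<open>n = 1, \<dots>, m\<close>. The entry \<^term>\<open>None\<close> stands for the factor \<open>1\<close>, and
  \<^term>\<open>Some j\<close> for the generator \<open>a\<^sub>j\<close>. Row \<open>0\<close> is \<^term>\<open>map Some js\<close>.
\<close>

definition all_rows :: "nat list \<Rightarrow> nat option list list \<Rightarrow> nat option list list" where
  "all_rows js A = map Some js # A"

definition is_normal_form :: "nat \<Rightarrow> nat list \<Rightarrow> nat option list list \<Rightarrow> bool" where
  "is_normal_form N js A \<longleftrightarrow>
     (\<exists>S. S \<subset> {..<N} \<and> js = cyclic_listing N S) \<and>
     (\<forall>row \<in> set A. length row = length js) \<and>
     (\<forall>n < length A. \<forall>l < length js.
        all_rows js A ! Suc n ! l \<in>
          (case all_rows js A ! n ! l of None \<Rightarrow> {None} | Some j \<Rightarrow> {None, Some (Suc j mod N)})) \<and>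
     (A \<noteq> [] \<longrightarrow> (\<exists>x \<in> set (last A). x \<noteq> None))"

definition factor :: "nat \<Rightarrow> nat option \<Rightarrow> 'k::field nTL_elt" where
  "factor N x = (case x of None \<Rightarrow> \<one>\<^bsub>nTL N\<^esub> | Some j \<Rightarrow> gen N j)"

text \<open>Row \<open>m\<close> is the leftmost block of the product, row \<open>0\<close> the rightmost one.\<close>

definition normal_form_value :: "nat \<Rightarrow> nat list \<Rightarrow> nat option list list \<Rightarrow> 'k::field nTL_elt" where
  "normal_form_value N js A =
     list_product (nTL N) (map (factor N) (concat (rev (all_rows js A))))"


section \<open>The representation on particle configurations\<close>

text \<open>
  An element of the free \<open>k[q]\<close>-module is given by its coordinates with respect to the basis
  \<open>v(I)\<close>, \<open>I \<subseteq> {1..N}\<close>.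
\<close>

type_synonym 'k fock = "nat set \<Rightarrow> 'k poly"

definition qvar :: "'k::field poly" where
  "qvar = [:0, 1:]"

definition scale :: "'k::field poly \<Rightarrow> 'k fock \<Rightarrow> 'k fock" where
  "scale c f = (\<lambda>K. c * f K)"

definition conf :: "nat set \<Rightarrow> 'k::field fock" where
  "conf I = (\<lambda>K. if K = I then 1 else 0)"

definition inversions :: "nat list \<Rightarrow> nat" where
  "inversions js = card {(s, t). s < t \<and> t < length js \<and> js ! t < js ! s}"

text \<open>The wedge product of the basis vectors with indices \<open>js\<close>, expanded in the basis \<open>v(I)\<close>.\<close>

definition wedge :: "nat list \<Rightarrow> 'k::field fock" where
  "wedge js = (if distinct js then scale ((- 1) ^ inversions js) (conf (set js)) else (\<lambda>_. 0))"

text \<open>For \<open>I \<subseteq> {1..N}\<close> with \<open>N \<in> I\<close>, the position \<open>N\<close> is the last entry of the sorted list.\<close>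

definition gen_on_conf :: "nat \<Rightarrow> nat \<Rightarrow> nat set \<Rightarrow> 'k::field fock" where
  "gen_on_conf N j I =
     (let js = sorted_list_of_set I in
      if j = 0 then (if N \<in> I then scale qvar (wedge (butlast js @ [1])) else (\<lambda>_. 0))
      else (if j \<in> I then wedge (map (\<lambda>i. if i = j then j + 1 else i) js) else (\<lambda>_. 0)))"

definition gen_action :: "nat \<Rightarrow> nat \<Rightarrow> 'k::field fock \<Rightarrow> 'k fock" where
  "gen_action N j f = (\<lambda>K. \<Sum>I\<in>Pow {1..N}. f I * gen_on_conf N j I K)"

definition free_action :: "nat \<Rightarrow> (fword \<Rightarrow>\<^sub>0 'k::field) \<Rightarrow> 'k fock \<Rightarrow> 'k fock" where
  "free_action N p f =
     (\<lambda>K. \<Sum>w\<in>Poly_Mapping.keys p.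
        [:Poly_Mapping.lookup p w:] * foldr (gen_action N) (letters w) f K)"

text \<open>
  The action of a residue class is that of any of its representatives; it is well defined for
  \<open>N \<ge> 3\<close>, see \<open>nTL_action_coset\<close> and \<open>nTL_action_gen\<close> below.
\<close>

definition nTL_action :: "nat \<Rightarrow> 'k::field nTL_elt \<Rightarrow> 'k fock \<Rightarrow> 'k fock" where
  "nTL_action N x f = (THE g. \<forall>p \<in> x. free_action N p f = g)"

definition acts_nontrivially_on :: "nat \<Rightarrow> 'k::field nTL_elt \<Rightarrow> nat set \<Rightarrow> bool" where
  "acts_nontrivially_on N x I \<longleftrightarrow> I \<subseteq> {1..N} \<and> nTL_action N x (conf I) \<noteq> (\<lambda>_. 0)"

definition minimal_input :: "nat \<Rightarrow> 'k::field nTL_elt \<Rightarrow> nat set \<Rightarrow> bool" where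
  "minimal_input N x I \<longleftrightarrow>
     acts_nontrivially_on N x I \<and> (\<forall>J. acts_nontrivially_on N x J \<longrightarrow> card I \<le> card J)"

definition has_output :: "nat \<Rightarrow> 'k::field nTL_elt \<Rightarrow> nat set \<Rightarrow> nat set \<Rightarrow> nat \<Rightarrow> bool" where
  "has_output N x I I' l \<longleftrightarrow> I' \<subseteq> {1..N} \<and>
     (nTL_action N x (conf I) = scale (qvar ^ l) (conf I') \<or>
      nTL_action N x (conf I) = scale (- (qvar ^ l)) (conf I'))"


section \<open>The action is well defined\<close>

lemma ring_free_algebra: "ring (free_algebra N :: (fword \<Rightarrow>\<^sub>0 'k::field) ring)"
proof (rule ringI)
  let ?F = "free_algebra N :: (fword \<Rightarrow>\<^sub>0 'k) ring"
  have add: "p \<oplus>\<^bsub>?F\<^esub> q \<in> carrier ?F" if "p \<in> carrier ?F" "q \<in> carrier ?F" for p q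
    using that Poly_Mapping.keys_add[of p q] by (auto simp: free_algebra_def)
  have mult: "p \<otimes>\<^bsub>?F\<^esub> q \<in> carrier ?F" if "p \<in> carrier ?F" "q \<in> carrier ?F" for p q
    using that keys_mult[of p q] by (fastforce simp: free_algebra_def plus_fword_def)
  show "abelian_group ?F"
  proof (rule abelian_groupI)
    fix p assume "p \<in> carrier ?F"
    then have "- p \<in> carrier ?F" "- p + p = 0"
      by (auto simp: free_algebra_def in_keys_iff)
    then show "\<exists>q\<in>carrier ?F. q \<oplus>\<^bsub>?F\<^esub> p = \<zero>\<^bsub>?F\<^esub>"
      by (intro bexI[of _ "- p"]) (simp_all add: free_algebra_def)
  qed (simp_all add: add, simp_all add: free_algebra_def add_ac)
  show "Group.monoid ?F"
  proof (rule monoidI)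
    show "\<one>\<^bsub>?F\<^esub> \<in> carrier ?F"
      by (simp add: free_algebra_def zero_fword_def)
  qed (simp_all add: mult, simp_all add: free_algebra_def mult.assoc)
qed (simp_all add: free_algebra_def distrib_left distrib_right)

lemma letter_in_carrier: "i < N \<Longrightarrow> (letter i :: fword \<Rightarrow>\<^sub>0 'k::field) \<in> carrier (free_algebra N)"
  by (simp add: free_algebra_def letter_def)

lemma free_algebra_minus:
  assumes "p \<in> carrier (free_algebra N)" "q \<in> carrier (free_algebra N)"
  shows "p - q \<in> carrier (free_algebra N :: (fword \<Rightarrow>\<^sub>0 'k::field) ring)"
  using assms Poly_Mapping.keys_diff[of p q] by (auto simp: free_algebra_def)

lemma nTL_relators_subset:
  "nTL_relators N \<subseteq> carrier (free_algebra N :: (fword \<Rightarrow>\<^sub>0 'k::field) ring)"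
proof -
  interpret ring "free_algebra N :: (fword \<Rightarrow>\<^sub>0 'k) ring"
    by (rule ring_free_algebra)
  have mult: "p * q \<in> carrier (free_algebra N)"
    if "p \<in> carrier (free_algebra N)" "q \<in> carrier (free_algebra N)" for p q :: "fword \<Rightarrow>\<^sub>0 'k"
    using m_closed[OF that] by (simp add: free_algebra_def)
  show ?thesis
    by (auto simp: nTL_relators_def intro!: mult free_algebra_minus letter_in_carrier)
qed

lemma free_algebra_induct [case_names single add]:
  fixes p :: "fword \<Rightarrow>\<^sub>0 'k::field"
  assumes single: "\<And>w c. P (Poly_Mapping.single w c)"
    and add: "\<And>p q. P p \<Longrightarrow> P q \<Longrightarrow> P (p + q)"
  shows "P p"
proof -
  have eq: "p = (\<Sum>w\<in>Poly_Mapping.keys p. Poly_Mapping.single w (Poly_Mapping.lookup p w))"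
  proof (rule poly_mapping_eqI)
    fix v
    have "Poly_Mapping.lookup
        (\<Sum>w\<in>Poly_Mapping.keys p. Poly_Mapping.single w (Poly_Mapping.lookup p w)) v
      = (\<Sum>w\<in>Poly_Mapping.keys p. if w = v then Poly_Mapping.lookup p w else 0)"
      by (simp only: lookup_sum lookup_single when_def)
    also have "\<dots> = Poly_Mapping.lookup p v"
      by (cases "v \<in> Poly_Mapping.keys p") (simp_all add: in_keys_iff)
    finally show "Poly_Mapping.lookup p v = Poly_Mapping.lookup
        (\<Sum>w\<in>Poly_Mapping.keys p. Poly_Mapping.single w (Poly_Mapping.lookup p w)) v" ..
  qed
  have "P (\<Sum>w\<in>A. Poly_Mapping.single w (Poly_Mapping.lookup p w))" if "finite A" for A
    using that
  proof induction
    case empty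
    show ?case using single[of 0 0] by simp
  next
    case (insert w A)
    then show ?case using single add by simp
  qed
  then have "P (\<Sum>w\<in>Poly_Mapping.keys p. Poly_Mapping.single w (Poly_Mapping.lookup p w))"
    using finite_keys by blast
  then show ?thesis by (simp only: eq[symmetric])
qed

lemma gen_action_add:
  "gen_action N j (\<lambda>K. f K + g K) = (\<lambda>K. gen_action N j f K + gen_action N j g K)"
  by (simp add: gen_action_def algebra_simps sum.distrib)

lemma gen_action_zero: "gen_action N j (\<lambda>_. 0) = (\<lambda>_. 0)"
  by (simp add: gen_action_def)

lemma gen_action_scale:
  "gen_action N j (\<lambda>K. c * f K) = (\<lambda>K. c * gen_action N j f K)"
  by (simp add: gen_action_def algebra_simps sum_distrib_left)

lemma word_action_add:
  "foldr (gen_action N) ws (\<lambda>K. f K + g K) =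
     (\<lambda>K. foldr (gen_action N) ws f K + foldr (gen_action N) ws g K)"
  by (induction ws) (simp_all add: gen_action_add)

lemma word_action_scale:
  "foldr (gen_action N) ws (\<lambda>K. c * f K) = (\<lambda>K. c * foldr (gen_action N) ws f K)"
  by (induction ws) (simp_all add: gen_action_scale)

lemma word_action_zero: "foldr (gen_action N) ws (\<lambda>_. 0) = (\<lambda>_. 0)"
  by (induction ws) (simp_all add: gen_action_zero)

lemma free_action_superset:
  assumes "finite A" "Poly_Mapping.keys p \<subseteq> A"
  shows "free_action N p f =
    (\<lambda>K. \<Sum>w\<in>A. [:Poly_Mapping.lookup p w:] * foldr (gen_action N) (letters w) f K)"
  unfolding free_action_def
  by (rule ext, rule sum.mono_neutral_left) (use assms in \<open>auto simp: in_keys_iff\<close>)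

lemma free_action_add_left:
  "free_action N (p + q) f = (\<lambda>K. free_action N p f K + free_action N q f K)"
proof -
  let ?A = "Poly_Mapping.keys p \<union> Poly_Mapping.keys q"
  have p: "free_action N p f =
      (\<lambda>K. \<Sum>w\<in>?A. [:Poly_Mapping.lookup p w:] * foldr (gen_action N) (letters w) f K)"
    by (rule free_action_superset) auto
  have q: "free_action N q f =
      (\<lambda>K. \<Sum>w\<in>?A. [:Poly_Mapping.lookup q w:] * foldr (gen_action N) (letters w) f K)"
    by (rule free_action_superset) auto
  have pq: "free_action N (p + q) f =
      (\<lambda>K. \<Sum>w\<in>?A. [:Poly_Mapping.lookup (p + q) w:] * foldr (gen_action N) (letters w) f K)"
    by (rule free_action_superset) (use Poly_Mapping.keys_add[of p q] in auto)
  have "[:Poly_Mapping.lookup (p + q) w:] = [:Poly_Mapping.lookup p w:] + [:Poly_Mapping.lookup q w:]" for w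
    by (simp add: lookup_add)
  then show ?thesis
    unfolding p q pq by (simp add: distrib_right sum.distrib del: add_pCons)
qed

lemma free_action_single:
  "free_action N (Poly_Mapping.single w c) f = (\<lambda>K. [:c:] * foldr (gen_action N) (letters w) f K)"
  by (subst free_action_superset[of "{w}"]) auto

lemma free_action_add_right:
  "free_action N p (\<lambda>K. f K + g K) = (\<lambda>K. free_action N p f K + free_action N p g K)"
  by (simp add: free_action_def word_action_add distrib_left sum.distrib del: mult_pCons_left)

lemma free_action_mult: "free_action N (p * q) f = free_action N p (free_action N q f)"
proof (induction p rule: free_algebra_induct)
  case (single u c)
  show ?case
  proof (induction q rule: free_algebra_induct)
    case (single w d)
    have "[:c * d:] = [:c:] * [:d:]" by simp
    then show ?case
      by (simp add: mult_single free_action_single plus_fword_def word_action_scale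
          mult.assoc del: mult_pCons_left mult_pCons_right)
  next
    case (add p q)
    then show ?case
      by (simp add: distrib_left free_action_add_left free_action_add_right)
  qed
next
  case (add p1 p2)
  then show ?case by (simp add: distrib_right free_action_add_left)
qed

lemma free_action_letter: "free_action N (letter i) f = gen_action N i f"
  by (simp add: letter_def free_action_single)

lemma free_action_zero_right: "free_action N p (\<lambda>_. 0) = (\<lambda>_. 0)"
  by (simp add: free_action_def word_action_zero)

lemma free_action_diff_left:
  "free_action N (p - q) f = (\<lambda>K. free_action N p f K - free_action N q f K)"
  using free_action_add_left[of N "p - q" q f] by simp


definition source :: "nat \<Rightarrow> nat \<Rightarrow> nat" where
  "source N j = (if j = 0 then N else j)"

definition step_coeff :: "nat \<Rightarrow> nat \<Rightarrow> 'k::field poly" where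
  "step_coeff j k = (if j = 0 then qvar * (- 1) ^ (k - 1) else 1)"

lemma inversions_sorted: "sorted js \<Longrightarrow> inversions js = 0"
proof -
  assume "sorted js"
  then have "{(s, t). s < t \<and> t < length js \<and> js ! t < js ! s} = {}"
    by (auto simp: sorted_iff_nth_mono dest: less_imp_le_nat leD)
  then show ?thesis by (simp only: inversions_def card.empty)
qed

lemma inversions_snoc_less:
  assumes "sorted js" "\<forall>x\<in>set js. a < x"
  shows "inversions (js @ [a]) = length js"
proof -
  have "{(s, t). s < t \<and> t < length (js @ [a]) \<and> (js @ [a]) ! t < (js @ [a]) ! s}
      = (\<lambda>s. (s, length js)) ` {..<length js}"
    (is "?L = ?R")
  proof (intro equalityI subsetI)
    fix x assume "x \<in> ?L"
    then obtain s t where x: "x = (s, t)" "s < t" "t < Suc (length js)"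
      "(js @ [a]) ! t < (js @ [a]) ! s" by auto
    have "t = length js"
    proof (rule ccontr)
      assume "t \<noteq> length js"
      then have "t < length js" using x by simp
      then show False using x sorted_nth_mono[OF assms(1), of s t] by (simp add: nth_append)
    qed
    then show "x \<in> ?R" using x by auto
  next
    fix x assume "x \<in> ?R"
    then show "x \<in> ?L" using assms(2) by (auto simp: nth_append)
  qed
  moreover have "inj_on (\<lambda>s. (s, length js)) {..<length js}"
    by (auto simp: inj_on_def)
  ultimately show ?thesis by (simp add: inversions_def card_image)
qed

lemma gen_on_conf_eq:
  assumes "2 \<le> N" "j < N" "I \<subseteq> {1..N}"
  shows "gen_on_conf N j I =
    (if source N j \<in> I \<and> Suc j \<notin> I
     then scale (step_coeff j (card I)) (conf (insert (Suc j) (I - {source N j})))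
     else (\<lambda>_. 0))"
proof -
  define js where "js = sorted_list_of_set I"
  have fin: "finite I" using assms(3) finite_subset by blast
  have js: "set js = I" "sorted js" "distinct js" "length js = card I"
    using fin by (simp_all add: js_def)
  show ?thesis
  proof (cases "j = 0")
    case True
    show ?thesis
    proof (cases "N \<in> I")
      case N: True
      then have ne: "js \<noteq> []" using js by auto
      have "last js = N"
      proof (rule antisym)
        show "last js \<le> N" using last_in_set[OF ne] js(1) assms(3) by auto
        show "N \<le> last js"
          using N js(1) sorted_wrt_append[of "(\<le>)" "butlast js" "[last js]"] js(2) ne
          by (metis Un_iff append_butlast_last_id empty_iff empty_set insert_iff list.simps(15)
              order_refl set_append)
      qed
      then have eq: "js = butlast js @ [N]" using ne by (metis append_butlast_last_id)
      have N': "N \<notin> set (butlast js)" using js(3) eq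
        by (metis distinct_append disjoint_iff list.set_intros(1))
      have set: "set (butlast js) = I - {N}"
        using js(1) N' by (subst (asm) eq) auto
      have srt: "sorted (butlast js)" "distinct (butlast js)"
        using js by (simp_all add: sorted_butlast distinct_butlast)
      have len: "length (butlast js) = card I - 1" using js by simp
      have inv: "inversions (butlast js @ [1]) = card I - 1" if "1 \<notin> I"
      proof -
        have "\<forall>x\<in>set (butlast js). 1 < x"
          using that assms(3) unfolding set by (auto simp: less_le)
        then show ?thesis using inversions_snoc_less srt len by metis
      qed
      show ?thesis using True N assms(1) set srt inv
        by (auto simp: gen_on_conf_def wedge_def scale_def source_def step_coeff_def
            js_def[symmetric] mult_ac)
    qed (use True in \<open>simp add: gen_on_conf_def source_def\<close>)
  next
    case False
    let ?h = "\<lambda>i. if i = j then j + 1 else i"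
    show ?thesis
    proof (cases "j \<in> I")
      case j: True
      show ?thesis
      proof (cases "Suc j \<in> I")
        case True
        have "\<not> inj_on ?h I" using j True unfolding inj_on_def
          by (metis Suc_eq_plus1 n_not_Suc_n)
        then have "\<not> distinct (map ?h js)" using js by (simp add: distinct_map)
        then show ?thesis using True False j
          by (simp add: gen_on_conf_def wedge_def js_def source_def)
      next
        case S: False
        have "inj_on ?h I" using S by (auto simp: inj_on_def)
        then have d: "distinct (map ?h js)" using js by (simp add: distinct_map)
        have "sorted (map ?h js)"
          unfolding sorted_map using js(2)
        proof (rule sorted_wrt_mono_rel[rotated])
          fix x y assume "x \<in> set js" "y \<in> set js" "x \<le> y"
          then show "?h x \<le> ?h y" using S js(1) by (cases "y = Suc j") (auto simp: le_less)
        qed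
        then have i: "inversions (map ?h js) = 0" by (rule inversions_sorted)
        have "set (map ?h js) = insert (Suc j) (I - {j})" using js(1) j by auto
        then show ?thesis using False S j d i
          by (simp add: gen_on_conf_def wedge_def js_def[symmetric] source_def step_coeff_def)
      qed
    qed (use False in \<open>simp add: gen_on_conf_def source_def\<close>)
  qed
qed

lemma gen_action_conf:
  assumes "2 \<le> N" "j < N" "I \<subseteq> {1..N}"
  shows "gen_action N j (scale c (conf I)) =
    (if source N j \<in> I \<and> Suc j \<notin> I
     then scale (c * step_coeff j (card I)) (conf (insert (Suc j) (I - {source N j})))
     else (\<lambda>_. 0))"
proof -
  have "gen_action N j (scale c (conf I)) = (\<lambda>K. c * gen_on_conf N j I K)"
    unfolding gen_action_def
  proof (rule ext)
    fix K
    have "(\<Sum>J\<in>Pow {1..N}. scale c (conf I) J * gen_on_conf N j J K) =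
        (\<Sum>J\<in>Pow {1..N}. if J = I then c * gen_on_conf N j I K else 0)"
      by (rule sum.cong) (auto simp: scale_def conf_def)
    also have "\<dots> = c * gen_on_conf N j I K" using assms by (subst sum.delta) auto
    finally show "(\<Sum>J\<in>Pow {1..N}. scale c (conf I) J * gen_on_conf N j J K) =
        c * gen_on_conf N j I K" .
  qed
  then show ?thesis by (auto simp: gen_on_conf_eq[OF assms] scale_def mult.assoc)
qed

lemma word_action_sum:
  assumes "finite A"
  shows "foldr (gen_action N) ws (\<lambda>K. \<Sum>I\<in>A. c I * g I K) =
    (\<lambda>K. \<Sum>I\<in>A. c I * foldr (gen_action N) ws (g I) K)"
  using assms
proof (induction A)
  case empty
  show ?case by (simp add: word_action_zero)
next
  case (insert I A)
  then show ?case by (simp add: word_action_add word_action_scale)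
qed

text \<open>A nonempty word acts as determined by its action on the basis.\<close>

lemma word_action_expand:
  fixes f :: "'k::field fock"
  assumes "2 \<le> N" "j < N"
  shows "foldr (gen_action N) ws (gen_action N j f) =
    (\<lambda>K. \<Sum>I\<in>Pow {1..N}. f I * foldr (gen_action N) ws (gen_action N j (conf I)) K)"
proof -
  have "gen_action N j (conf I :: 'k fock) = gen_on_conf N j I" if "I \<subseteq> {1..N}" for I
  proof -
    have "gen_action N j (scale 1 (conf I :: 'k fock)) = gen_on_conf N j I"
      by (simp add: gen_action_conf[OF assms that] gen_on_conf_eq[OF assms that])
    then show ?thesis by (simp add: scale_def)
  qed
  then have "gen_action N j f = (\<lambda>K. \<Sum>I\<in>Pow {1..N}. f I * gen_action N j (conf I) K)"
    unfolding gen_action_def[of N j f] by (intro ext sum.cong) auto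
  then show ?thesis
    by (simp only: word_action_sum finite_Pow_iff finite_atLeastAtMost)
qed

lemma word_action_eqI:
  fixes f :: "'k::field fock"
  assumes "2 \<le> N" "i < N" "j < N"
    and "\<And>I. I \<subseteq> {1..N} \<Longrightarrow> foldr (gen_action N) us (gen_action N i (scale 1 (conf I :: 'k fock))) =
      foldr (gen_action N) ws (gen_action N j (scale 1 (conf I)))"
  shows "foldr (gen_action N) us (gen_action N i f) = foldr (gen_action N) ws (gen_action N j f)"
  unfolding word_action_expand[OF assms(1,2), of us f] word_action_expand[OF assms(1,3), of ws f]
  using assms(4) by (intro ext sum.cong) (auto simp: scale_def)

lemma word_action_zeroI:
  fixes f :: "'k::field fock"
  assumes "2 \<le> N" "i < N"
    and "\<And>I. I \<subseteq> {1..N} \<Longrightarrow>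
      foldr (gen_action N) us (gen_action N i (scale 1 (conf I :: 'k fock))) = (\<lambda>_. 0)"
  shows "foldr (gen_action N) us (gen_action N i f) = (\<lambda>_. 0)"
  unfolding word_action_expand[OF assms(1,2), of us f]
  using assms(3) by (intro ext sum.neutral) (auto simp: scale_def)

definition movable :: "nat \<Rightarrow> nat \<Rightarrow> nat set \<Rightarrow> bool" where
  "movable N j I \<longleftrightarrow> source N j \<in> I \<and> Suc j \<notin> I"

definition move :: "nat \<Rightarrow> nat \<Rightarrow> nat set \<Rightarrow> nat set" where
  "move N j I = insert (Suc j) (I - {source N j})"

lemma move_in_range: "j < N \<Longrightarrow> I \<subseteq> {1..N} \<Longrightarrow> move N j I \<subseteq> {1..N}"
  by (auto simp: move_def)

lemma card_move:
  assumes "I \<subseteq> {1..N}" "movable N j I"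
  shows "card (move N j I) = card I"
proof -
  have "finite I" using assms(1) by (rule finite_subset) simp
  then have "Suc (card (I - {source N j})) = card I"
    using assms(2) by (intro card_Suc_Diff1) (auto simp: movable_def)
  moreover have "card (move N j I) = Suc (card (I - {source N j}))"
    unfolding move_def using \<open>finite I\<close> assms(2)
    by (intro card_insert_disjoint) (auto simp: movable_def)
  ultimately show ?thesis by simp
qed

lemma gen_action_movable:
  "2 \<le> N \<Longrightarrow> j < N \<Longrightarrow> I \<subseteq> {1..N} \<Longrightarrow> movable N j I \<Longrightarrow>
    gen_action N j (scale c (conf I)) = scale (c * step_coeff j (card I)) (conf (move N j I))"
  by (subst gen_action_conf) (simp_all add: movable_def move_def)

lemma gen_action_not_movable:
  "2 \<le> N \<Longrightarrow> j < N \<Longrightarrow> I \<subseteq> {1..N} \<Longrightarrow> \<not> movable N j I \<Longrightarrow>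
    gen_action N j (scale c (conf I)) = (\<lambda>_. 0)"
  by (subst gen_action_conf) (auto simp: movable_def)

lemma relator_square:
  fixes f :: "'k::field fock"
  assumes "2 \<le> N" "i < N"
  shows "gen_action N i (gen_action N i f) = (\<lambda>_. 0)"
proof -
  have "gen_action N i (gen_action N i (scale 1 (conf I :: 'k fock))) = (\<lambda>_. 0)" if I: "I \<subseteq> {1..N}" for I
  proof (cases "movable N i I")
    case True
    have "\<not> movable N i (move N i I)" by (simp add: movable_def move_def)
    then show ?thesis using True assms I move_in_range[OF assms(2) I]
      by (simp add: gen_action_movable gen_action_not_movable)
  qed (use assms I in \<open>simp add: gen_action_not_movable gen_action_zero\<close>)
  then have "foldr (gen_action N) [i] (gen_action N i f) = (\<lambda>_. 0)"
    by - (rule word_action_zeroI[OF assms], simp)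
  then show ?thesis by simp
qed

lemma relator_cube:
  fixes f :: "'k::field fock"
  assumes "3 \<le> N" "i < N" "j < N" "j = Suc i mod N \<or> i = Suc j mod N"
  shows "gen_action N i (gen_action N j (gen_action N i f)) = (\<lambda>_. 0)"
proof -
  have two: "2 \<le> N" using assms(1) by simp
  have "gen_action N i (gen_action N j (gen_action N i (scale 1 (conf I :: 'k fock)))) = (\<lambda>_. 0)"
    if I: "I \<subseteq> {1..N}" for I
  proof (cases "movable N i I")
    case i: True
    have J: "move N i I \<subseteq> {1..N}" by (rule move_in_range[OF assms(2) I])
    show ?thesis
    proof (cases "movable N j (move N i I)")
      case j: True
      have K: "move N j (move N i I) \<subseteq> {1..N}" by (rule move_in_range[OF assms(3) J])
      have "\<not> movable N i (move N j (move N i I))"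
        using assms by (auto simp: movable_def move_def source_def mod_Suc split: if_splits)
      then show ?thesis using i j I J K assms(2,3) two
        by (simp add: gen_action_movable gen_action_not_movable)
    qed (use i I J assms(2,3) two in
        \<open>simp add: gen_action_movable gen_action_not_movable gen_action_zero\<close>)
  qed (use assms(2,3) two I in \<open>simp add: gen_action_not_movable gen_action_zero\<close>)
  then have "foldr (gen_action N) [i, j] (gen_action N i f) = (\<lambda>_. 0)"
    by - (rule word_action_zeroI[OF two assms(2)], simp)
  then show ?thesis by simp
qed

lemma relator_commute:
  fixes f :: "'k::field fock"
  assumes "2 \<le> N" "i < N" "j < N" "i \<noteq> Suc j mod N" "j \<noteq> Suc i mod N"
  shows "gen_action N i (gen_action N j f) = gen_action N j (gen_action N i f)"
proof (cases "i = j")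
  case False
  have ne: "source N i \<noteq> source N j" "source N i \<noteq> Suc j" "source N j \<noteq> Suc i"
    using assms False by (auto simp: source_def mod_Suc split: if_splits)
  have "gen_action N i (gen_action N j (scale 1 (conf I :: 'k fock))) =
      gen_action N j (gen_action N i (scale 1 (conf I)))" if I: "I \<subseteq> {1..N}" for I
  proof -
    have J: "move N i I \<subseteq> {1..N}" by (rule move_in_range[OF assms(2) I])
    have K: "move N j I \<subseteq> {1..N}" by (rule move_in_range[OF assms(3) I])
    have mv: "movable N j (move N i I) = movable N j I" "movable N i (move N j I) = movable N i I"
      using ne False by (auto simp: movable_def move_def)
    have eq: "move N j (move N i I) = move N i (move N j I)"
      using ne by (auto simp: move_def)
    note rules = gen_action_movable[OF assms(1,2)] gen_action_movable[OF assms(1,3)]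
      gen_action_not_movable[OF assms(1,2)] gen_action_not_movable[OF assms(1,3)]
    show ?thesis
    proof (cases "movable N i I \<and> movable N j I")
      case True
      then show ?thesis using I J K mv eq
        by (simp add: rules card_move mult.commute)
    next
      case False
      then show ?thesis using I J K mv
        by (cases "movable N i I"; cases "movable N j I")
          (simp_all add: rules gen_action_zero)
    qed
  qed
  then have "foldr (gen_action N) [i] (gen_action N j f) =
      foldr (gen_action N) [j] (gen_action N i f)"
    by - (rule word_action_eqI[OF assms(1,3,2)], simp)
  then show ?thesis by simp
qed simp

lemma free_action_relator:
  assumes "3 \<le> N" "p \<in> nTL_relators N"
  shows "free_action N p f = (\<lambda>_. 0)"
proof -
  have cong1: "[int (Suc j mod N) - int j = 1] (mod int N)" for j
    by (simp add: cong_def of_nat_mod mod_diff_left_eq)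
  have cong2: "[int j - int (Suc j mod N) = - 1] (mod int N)" for j
    by (simp add: cong_def of_nat_mod mod_diff_right_eq)
  have two: "2 \<le> N" using assms(1) by simp
  have lt: "Suc i mod N < N" for i using assms(1) by simp
  from assms(2) consider
      i where "i < N" "p = letter i * letter i"
    | i j where "i < N" "j < N" "\<not> [int i - int j = 1] (mod int N)"
        "\<not> [int i - int j = - 1] (mod int N)" "p = letter i * letter j - letter j * letter i"
    | i where "i < N" "p = letter i * letter (Suc i mod N) * letter i"
    | i where "i < N" "p = letter (Suc i mod N) * letter i * letter (Suc i mod N)"
    unfolding nTL_relators_def by blast
  then show ?thesis
  proof cases
    case 1
    then show ?thesis
      by (simp add: free_action_mult free_action_letter relator_square[OF two])
  next
    case 2
    then have "i \<noteq> Suc j mod N" "j \<noteq> Suc i mod N" using cong1 cong2 by blast+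
    then have "gen_action N i (gen_action N j f) = gen_action N j (gen_action N i f)"
      using 2 two by (intro relator_commute)
    then show ?thesis
      by (simp add: 2 free_action_mult free_action_letter free_action_diff_left)
  next
    case 3
    have "gen_action N i (gen_action N (Suc i mod N) (gen_action N i f)) = (\<lambda>_. 0)"
      by (rule relator_cube) (use 3 lt assms(1) in simp_all)
    then show ?thesis by (simp only: 3 free_action_mult free_action_letter)
  next
    case 4
    have "gen_action N (Suc i mod N) (gen_action N i (gen_action N (Suc i mod N) f)) = (\<lambda>_. 0)"
      by (rule relator_cube) (use 4 lt assms(1) in simp_all)
    then show ?thesis by (simp only: 4 free_action_mult free_action_letter)
  qed
qed

lemma free_action_ideal:
  fixes p :: "fword \<Rightarrow>\<^sub>0 'k::field"
  assumes "3 \<le> N" "p \<in> nTL_ideal N"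
  shows "free_action N p f = (\<lambda>_. 0)"
proof -
  let ?F = "free_algebra N :: (fword \<Rightarrow>\<^sub>0 'k) ring"
  let ?J = "{p \<in> carrier ?F. \<forall>f. free_action N p f = (\<lambda>_. 0)}"
  interpret ring ?F by (rule ring_free_algebra)
  have zero: "free_action N 0 f = (\<lambda>_. 0)" for f :: "'k fock"
    by (simp add: free_action_def)
  have neg: "\<ominus>\<^bsub>?F\<^esub> x = - x" if "x \<in> carrier ?F" for x
    using that free_algebra_minus[of 0 N x] zero_closed
    by (intro minus_equality) (auto simp: free_algebra_def)
  have "ideal ?J ?F"
  proof (rule idealI)
    show "subgroup ?J (add_monoid ?F)"
    proof
      fix x assume x: "x \<in> ?J"
      then have "- x \<in> ?J"
        using free_algebra_minus[of 0 N x] zero_closed free_action_diff_left[of N 0 x]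
        by (auto simp: zero free_algebra_def)
      then show "inv\<^bsub>add_monoid ?F\<^esub> x \<in> ?J"
        using neg x by (simp add: a_inv_def)
    next
      fix x y assume "x \<in> ?J" "y \<in> ?J"
      then show "x \<otimes>\<^bsub>add_monoid ?F\<^esub> y \<in> ?J"
        using a_closed[of x y] by (auto simp: free_algebra_def free_action_add_left)
    qed (auto simp: free_algebra_def zero)
  next
    fix a x assume "a \<in> ?J" "x \<in> carrier ?F"
    then show "x \<otimes>\<^bsub>?F\<^esub> a \<in> ?J" "a \<otimes>\<^bsub>?F\<^esub> x \<in> ?J"
      using m_closed[of x a] m_closed[of a x]
      by (auto simp: free_algebra_def free_action_mult free_action_zero_right)
  qed (rule ring_free_algebra)
  moreover have "nTL_relators N \<subseteq> ?J"
    using nTL_relators_subset free_action_relator[OF assms(1)] by blast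
  ultimately have "nTL_ideal N \<subseteq> ?J"
    unfolding nTL_ideal_def by (rule genideal_minimal)
  then show ?thesis using assms(2) by blast
qed

lemma nTL_action_coset:
  fixes p :: "fword \<Rightarrow>\<^sub>0 'k::field"
  assumes "3 \<le> N" "p \<in> carrier (free_algebra N)"
  shows "nTL_action N (nTL_ideal N +>\<^bsub>free_algebra N\<^esub> p) f = free_action N p f"
proof -
  let ?F = "free_algebra N :: (fword \<Rightarrow>\<^sub>0 'k) ring"
  interpret ring ?F by (rule ring_free_algebra)
  interpret ideal "nTL_ideal N" ?F
    unfolding nTL_ideal_def by (rule genideal_ideal[OF nTL_relators_subset])
  have "free_action N p' f = free_action N p f" if "p' \<in> nTL_ideal N +>\<^bsub>?F\<^esub> p" for p'
    using that
    by (auto simp: a_r_coset_def r_coset_def free_algebra_def free_action_add_left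
        free_action_ideal[OF assms(1)])
  moreover have "p \<in> nTL_ideal N +>\<^bsub>?F\<^esub> p" using assms(2) by (rule a_rcos_self)
  ultimately show ?thesis unfolding nTL_action_def by (intro the_equality) (blast, metis)
qed

lemma nTL_action_gen:
  assumes "3 \<le> N" "i < N"
  shows "nTL_action N (gen N i) f = gen_action N i f"
  unfolding gen_def
  by (simp only: nTL_action_coset[OF assms(1) letter_in_carrier[OF assms(2)]] free_action_letter)

end

theory Submission
  imports Defs
begin

text \<open>
  Everything is read off from the projections of a word to its letters \<open>j - 1\<close> and \<open>j\<close>, for the
  residues \<open>j\<close> modulo \<open>N\<close>. Two words with the same projections differ only by commutations of
  letters that are not neighbours on the circle, so they represent the same monomial
  (\<open>same_heap_monomial_of\<close>). If the monomial is nonzero, then each projection alternates between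
  its two letters (\<open>nonzero_alternating\<close>), because two letters \<open>i\<close> that do not enclose both
  neighbours of \<open>i\<close> produce \<open>0\<close>. An alternating list over two letters is determined by its last
  letter and by the numbers of the two letters. The last letter of the projection to \<open>j - 1\<close> and
  \<open>j\<close> is \<open>j\<close> exactly if \<open>j\<close> lies in the set \<open>S\<close> of first indices. Hence \<open>S\<close> and the numbers of
  occurrences of all letters determine a nonzero monomial (\<open>alternating_same_heap\<close>).

  These data are visible in the representation. A word, acting from its right end, moves one
  particle from site \<open>j\<close> to site \<open>j + 1\<close> for each letter \<open>j\<close>. At the first use of an index
  \<open>j\<close> in \<open>S\<close> no particle can have reached site \<open>j\<close> yet, so every configuration on which the word
  acts nontrivially contains \<open>S\<close>. On \<open>S\<close> itself the alternation makes sure that at each step the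
  required particle is present and its target is free. So \<open>S\<close> is the unique minimal input. Counting
  the particles that enter and leave each site expresses the number of letters \<open>j\<close> by the number of
  letters \<open>j - 1\<close>, the input and the output, and the power of \<open>q\<close> is the number of letters \<open>0\<close>.
  Going once around the circle recovers all these numbers, which proves that input, output and power
  of \<open>q\<close> determine the monomial. In particular, nonzero words for the same monomial have the
  same projections.

  For the normal form, the rightmost occurrences of the letters in \<open>S\<close> can be moved to the right end
  of the word, in the order of the cyclic listing (\<open>peel_row\<close>). By alternation the first indices of
  what remains are successors of elements of \<open>S\<close>, so that row after row can be split off
  (\<open>rows_exist\<close>). Conversely the first indices of a product of rows are the entries of its
  rightmost row, which is therefore determined by the projections, and can be cancelled from them;
  this gives uniqueness (\<open>rows_unique\<close>).
\<close>

section \<open>Neighbours on the circle\<close>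

definition cpred :: "nat \<Rightarrow> nat \<Rightarrow> nat" where
  "cpred N i = (i + N - 1) mod N"

definition csuc :: "nat \<Rightarrow> nat \<Rightarrow> nat" where
  "csuc N i = Suc i mod N"

lemma csuc_if: "i < N \<Longrightarrow> csuc N i = (if Suc i = N then 0 else Suc i)"
  by (simp add: csuc_def)

lemma cpred_if: "i < N \<Longrightarrow> cpred N i = (if i = 0 then N - 1 else i - 1)"
proof -
  assume i: "i < N"
  show ?thesis
  proof (cases i)
    case (Suc k)
    then have "i + N - 1 = k + N" by simp
    then show ?thesis using i Suc by (simp add: cpred_def)
  qed (use i in \<open>simp add: cpred_def\<close>)
qed

context
  fixes N :: nat
  assumes N3: "3 \<le> N"
begin

lemma csuc_less [simp]: "csuc N i < N"
  using N3 by (simp add: csuc_def)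

lemma cpred_less [simp]: "cpred N i < N"
  using N3 by (simp add: cpred_def)

lemma csuc_cpred [simp]: "i < N \<Longrightarrow> csuc N (cpred N i) = i"
  using csuc_if[of "cpred N i"] by (auto simp: cpred_if)

lemma cpred_csuc [simp]: "i < N \<Longrightarrow> cpred N (csuc N i) = i"
  using cpred_if[of "csuc N i"] by (auto simp: csuc_if)

lemma csuc_neq [simp]: "i < N \<Longrightarrow> csuc N i \<noteq> i" "i < N \<Longrightarrow> i \<noteq> csuc N i"
  using N3 by (auto simp: csuc_if)

lemma cpred_neq [simp]: "i < N \<Longrightarrow> cpred N i \<noteq> i" "i < N \<Longrightarrow> i \<noteq> cpred N i"
  using N3 by (auto simp: cpred_if)

lemma csuc_eq_iff: "i < N \<Longrightarrow> j < N \<Longrightarrow> csuc N i = csuc N j \<longleftrightarrow> i = j"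
  by (metis cpred_csuc)

lemma not_adjacentD:
  assumes "i < N" "j < N" "i \<noteq> csuc N j" "j \<noteq> csuc N i"
  shows "\<not> [int i - int j = 1] (mod int N)" "\<not> [int i - int j = - 1] (mod int N)"
proof -
  have *: "a = csuc N b" if "a < N" "b < N" "[int a - int b = 1] (mod int N)" for a b
  proof -
    have "[int a = int (Suc b)] (mod int N)"
      using cong_add[OF that(3) cong_refl[of "int b"]] by simp
    then have "[a = Suc b] (mod N)" by (simp only: cong_int_iff)
    then show ?thesis using that(1) by (simp add: cong_def csuc_def)
  qed
  show "\<not> [int i - int j = 1] (mod int N)" using * assms by blast
  show "\<not> [int i - int j = - 1] (mod int N)"
    using *[of j i] assms cong_minus_minus_iff[of "int i - int j" "- 1" "int N"] by auto
qed

section \<open>Monomials in the quotient algebra\<close>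

lemma single_word_mult:
  "Poly_Mapping.single (Word u) (1 :: 'k::field) * Poly_Mapping.single (Word v) 1 =
     Poly_Mapping.single (Word (u @ v)) 1"
  by (simp add: mult_single plus_fword_def)

lemma single_in_carrier:
  "set w \<subseteq> {..<N} \<Longrightarrow>
     (Poly_Mapping.single (Word w) 1 :: fword \<Rightarrow>\<^sub>0 'k::field) \<in> carrier (free_algebra N)"
  by (simp add: free_algebra_def)

lemma ideal_nTL: "ideal (nTL_ideal N) (free_algebra N :: (fword \<Rightarrow>\<^sub>0 'k::field) ring)"
  unfolding nTL_ideal_def by (rule ring.genideal_ideal[OF ring_free_algebra nTL_relators_subset])

lemma ring_nTL: "ring (nTL N :: 'k::field nTL_elt ring)"
  unfolding nTL_def by (rule ideal.quotient_is_ring[OF ideal_nTL])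

lemma monomial_of_coset:
  "set w \<subseteq> {..<N} \<Longrightarrow> (monomial_of N w :: 'k::field nTL_elt) =
     nTL_ideal N +>\<^bsub>free_algebra N\<^esub> Poly_Mapping.single (Word w) 1"
proof (induction w)
  case Nil
  have "(1 :: fword \<Rightarrow>\<^sub>0 'k) = Poly_Mapping.single (Word []) 1"
    by (metis single_one zero_fword_def)
  then show ?case
    by (simp add: monomial_of_def list_product_def nTL_def FactRing_def free_algebra_def)
next
  case (Cons i w)
  let ?F = "free_algebra N :: (fword \<Rightarrow>\<^sub>0 'k) ring"
  have "monomial_of N (i # w) = gen N i \<otimes>\<^bsub>nTL N\<^esub> (monomial_of N w :: 'k nTL_elt)"
    by (simp add: monomial_of_def list_product_def)
  also have "\<dots> = rcoset_mult ?F (nTL_ideal N) (nTL_ideal N +>\<^bsub>?F\<^esub> letter i)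
      (nTL_ideal N +>\<^bsub>?F\<^esub> Poly_Mapping.single (Word w) 1)"
    using Cons by (simp add: gen_def nTL_def FactRing_def)
  also have "\<dots> = nTL_ideal N +>\<^bsub>?F\<^esub> (letter i \<otimes>\<^bsub>?F\<^esub> Poly_Mapping.single (Word w) 1)"
    using Cons.prems by (intro ideal.rcoset_mult_add[OF ideal_nTL] letter_in_carrier single_in_carrier) auto
  also have "letter i \<otimes>\<^bsub>?F\<^esub> Poly_Mapping.single (Word w) 1 = Poly_Mapping.single (Word (i # w)) 1"
    using single_word_mult[of "[i]" w] by (simp add: free_algebra_def letter_def)
  finally show ?case .
qed

lemma monomial_of_closed:
  "set w \<subseteq> {..<N} \<Longrightarrow> (monomial_of N w :: 'k::field nTL_elt) \<in> carrier (nTL N)"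
  unfolding monomial_of_coset nTL_def
  by (rule ring_hom_closed[OF ideal.rcos_ring_hom[OF ideal_nTL] single_in_carrier])

lemma monomial_of_append:
  assumes "set u \<subseteq> {..<N}" "set v \<subseteq> {..<N}"
  shows "(monomial_of N (u @ v) :: 'k::field nTL_elt) =
    monomial_of N u \<otimes>\<^bsub>nTL N\<^esub> monomial_of N v"
proof -
  let ?F = "free_algebra N :: (fword \<Rightarrow>\<^sub>0 'k) ring"
  let ?s = "\<lambda>w. Poly_Mapping.single (Word w) 1 :: fword \<Rightarrow>\<^sub>0 'k"
  have "nTL_ideal N +>\<^bsub>?F\<^esub> (?s u \<otimes>\<^bsub>?F\<^esub> ?s v) =
      (nTL_ideal N +>\<^bsub>?F\<^esub> ?s u) \<otimes>\<^bsub>?F Quot nTL_ideal N\<^esub> (nTL_ideal N +>\<^bsub>?F\<^esub> ?s v)"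
    by (rule ring_hom_mult[OF ideal.rcos_ring_hom[OF ideal_nTL]
        single_in_carrier[OF assms(1)] single_in_carrier[OF assms(2)]])
  moreover have "?s u \<otimes>\<^bsub>?F\<^esub> ?s v = ?s (u @ v)"
    by (simp add: free_algebra_def single_word_mult)
  ultimately show ?thesis
    using assms by (simp add: monomial_of_coset nTL_def)
qed

lemma monomial_of_replace:
  assumes "(monomial_of N u :: 'k::field nTL_elt) = monomial_of N v"
    and "set u \<subseteq> {..<N}" "set v \<subseteq> {..<N}" "set x \<subseteq> {..<N}" "set y \<subseteq> {..<N}"
  shows "(monomial_of N (x @ u @ y) :: 'k nTL_elt) = monomial_of N (x @ v @ y)"
  using assms by (simp add: monomial_of_append)

lemma monomial_of_zero_factor:
  assumes "(monomial_of N u :: 'k::field nTL_elt) = \<zero>\<^bsub>nTL N\<^esub>"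
    and "set u \<subseteq> {..<N}" "set x \<subseteq> {..<N}" "set y \<subseteq> {..<N}"
  shows "(monomial_of N (x @ u @ y) :: 'k nTL_elt) = \<zero>\<^bsub>nTL N\<^esub>"
proof -
  interpret ring "nTL N :: 'k nTL_elt ring" by (rule ring_nTL)
  show ?thesis using assms by (simp add: monomial_of_append monomial_of_closed)
qed

lemma coset_relator:
  "p \<in> nTL_relators N \<Longrightarrow>
    nTL_ideal N +>\<^bsub>free_algebra N\<^esub> p = \<zero>\<^bsub>nTL N :: 'k::field nTL_elt ring\<^esub>"
proof -
  assume p: "p \<in> nTL_relators N"
  interpret ideal "nTL_ideal N" "free_algebra N :: (fword \<Rightarrow>\<^sub>0 'k) ring" by (rule ideal_nTL)
  have "p \<in> nTL_ideal N"
    using p genideal_self[OF nTL_relators_subset] by (auto simp: nTL_ideal_def)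
  then show ?thesis by (simp add: a_rcos_const nTL_def FactRing_def)
qed

lemma monomial_of_square: "i < N \<Longrightarrow> (monomial_of N [i, i] :: 'k::field nTL_elt) = \<zero>\<^bsub>nTL N\<^esub>"
  by (subst monomial_of_coset, simp, rule coset_relator)
    (auto simp: nTL_relators_def letter_def single_word_mult)

lemma monomial_of_braid:
  assumes "i < N"
  shows "(monomial_of N [i, csuc N i, i] :: 'k::field nTL_elt) = \<zero>\<^bsub>nTL N\<^esub>"
    and "(monomial_of N [csuc N i, i, csuc N i] :: 'k::field nTL_elt) = \<zero>\<^bsub>nTL N\<^esub>"
proof -
  have "letter i * letter (Suc i mod N) * letter i \<in> (nTL_relators N :: (fword \<Rightarrow>\<^sub>0 'k) set)"
    "letter (Suc i mod N) * letter i * letter (Suc i mod N)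
      \<in> (nTL_relators N :: (fword \<Rightarrow>\<^sub>0 'k) set)"
    using assms unfolding nTL_relators_def by blast+
  then have "Poly_Mapping.single (Word [i, csuc N i, i]) 1 \<in> (nTL_relators N :: (fword \<Rightarrow>\<^sub>0 'k) set)"
    "Poly_Mapping.single (Word [csuc N i, i, csuc N i]) 1 \<in> (nTL_relators N :: (fword \<Rightarrow>\<^sub>0 'k) set)"
    by (simp_all add: letter_def single_word_mult csuc_def)
  from this[THEN coset_relator]
  show "(monomial_of N [i, csuc N i, i] :: 'k::field nTL_elt) = \<zero>\<^bsub>nTL N\<^esub>"
    "(monomial_of N [csuc N i, i, csuc N i] :: 'k::field nTL_elt) = \<zero>\<^bsub>nTL N\<^esub>"
    using assms by (simp_all add: monomial_of_coset)
qed

lemma monomial_of_commute: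
  assumes "i < N" "j < N" "i \<noteq> csuc N j" "j \<noteq> csuc N i"
  shows "(monomial_of N [i, j] :: 'k::field nTL_elt) = monomial_of N [j, i]"
proof -
  let ?F = "free_algebra N :: (fword \<Rightarrow>\<^sub>0 'k) ring"
  let ?s = "\<lambda>w. Poly_Mapping.single (Word w) 1 :: fword \<Rightarrow>\<^sub>0 'k"
  interpret ideal "nTL_ideal N" ?F by (rule ideal_nTL)
  have c: "?s [i, j] \<in> carrier ?F" "?s [j, i] \<in> carrier ?F"
    using assms by (simp_all add: single_in_carrier)
  have "?s [i, j] - ?s [j, i] \<in> nTL_relators N"
    using assms not_adjacentD[OF assms] by (auto simp: nTL_relators_def letter_def single_word_mult)
  then have d: "?s [i, j] - ?s [j, i] \<in> nTL_ideal N"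
    using genideal_self[OF nTL_relators_subset] by (auto simp: nTL_ideal_def)
  have "?s [i, j] \<in> nTL_ideal N +>\<^bsub>?F\<^esub> ?s [j, i]"
    unfolding a_r_coset_def r_coset_def
    by (auto simp: free_algebra_def intro!: bexI[OF _ d])
  then have "nTL_ideal N +>\<^bsub>?F\<^esub> ?s [j, i] = nTL_ideal N +>\<^bsub>?F\<^esub> ?s [i, j]"
    by (intro a_repr_independence' c)
  then show ?thesis using assms by (simp add: monomial_of_coset)
qed

lemma monomial_of_commute_word:
  assumes "i < N" "set x \<subseteq> {..<N}" "cpred N i \<notin> set x" "csuc N i \<notin> set x"
  shows "(monomial_of N (i # x) :: 'k::field nTL_elt) = monomial_of N (x @ [i])"
  using assms(2-)
proof (induction x)
  case (Cons j x)
  have j: "j < N" "i \<noteq> csuc N j" "j \<noteq> csuc N i" using Cons.prems assms(1) by auto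
  have "(monomial_of N (i # j # x) :: 'k nTL_elt) = monomial_of N ([] @ [i, j] @ x)" by simp
  also have "\<dots> = monomial_of N ([] @ [j, i] @ x)"
    using Cons.prems j assms(1) by (intro monomial_of_replace monomial_of_commute) auto
  also have "\<dots> = monomial_of N ([j] @ (i # x) @ [])" by simp
  also have "\<dots> = monomial_of N ([j] @ (x @ [i]) @ [])"
    using Cons assms(1) by (intro monomial_of_replace) auto
  finally show ?case by simp
qed simp

text \<open>
  For an innermost pair of letters \<open>i\<close> that does not enclose both neighbours, let \<open>j\<close> be the
  neighbour that it may enclose. If \<open>j\<close> does not occur in between, the two letters \<open>i\<close> can be
  brought together. If it occurs once, a factor \<open>a\<^sub>i a\<^sub>j a\<^sub>i\<close> appears. If it occurs
  twice, then two letters \<open>j\<close> enclose no \<open>i\<close>, and the claim follows from that for a shorter word.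
\<close>

lemma monomial_of_repeat_zero:
  assumes "i < N" "set x \<subseteq> {..<N}" "cpred N i \<notin> set x \<or> csuc N i \<notin> set x"
  shows "(monomial_of N (i # x @ [i]) :: 'k::field nTL_elt) = \<zero>\<^bsub>nTL N\<^esub>"
  using assms
proof (induction "length x" arbitrary: i x rule: less_induct)
  case less
  note zero = monomial_of_zero_factor[where 'k = 'k]
  show ?case
  proof (cases "i \<in> set x")
    case True
    then obtain u v where x: "x = u @ i # v" by (auto dest: split_list)
    have "(monomial_of N (i # u @ [i]) :: 'k nTL_elt) = \<zero>\<^bsub>nTL N\<^esub>"
      using less.prems x by (intro less.hyps) auto
    from zero[OF this, of "[]" "v @ [i]"] show ?thesis using less.prems x by simp
  next
    case i: False
    show ?thesis
    proof (cases "cpred N i \<notin> set x \<and> csuc N i \<notin> set x")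
      case True
      then have "(monomial_of N ([] @ (i # x) @ [i]) :: 'k nTL_elt) = monomial_of N ([] @ (x @ [i]) @ [i])"
        using less.prems by (intro monomial_of_replace monomial_of_commute_word) auto
      also have "\<dots> = monomial_of N (x @ [i, i] @ [])" by simp
      also have "\<dots> = \<zero>\<^bsub>nTL N\<^esub>"
        using less.prems by (intro zero monomial_of_square) auto
      finally show ?thesis by simp
    next
      case False
      define j where "j = (if cpred N i \<in> set x then cpred N i else csuc N i)"
      have j: "j \<in> set x" "j < N" using False less.prems by (auto simp: j_def)
      obtain u v where x: "x = u @ j # v" "j \<notin> set u" using split_list_first[OF j(1)] by blast
      show ?thesis
      proof (cases "j \<in> set v")
        case True
        then obtain v1 v2 where v: "v = v1 @ j # v2" by (auto dest: split_list)
        have "i = cpred N j \<or> i = csuc N j" using less.prems(1) by (auto simp: j_def)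
        then have "(monomial_of N (j # v1 @ [j]) :: 'k nTL_elt) = \<zero>\<^bsub>nTL N\<^esub>"
          using less.prems i x v j by (intro less.hyps) auto
        from zero[OF this, of "i # u" "v2 @ [i]"] show ?thesis
          using less.prems x v j by simp
      next
        case False
        have nb: "cpred N i \<notin> set u" "csuc N i \<notin> set u" "cpred N i \<notin> set v" "csuc N i \<notin> set v"
          using x False less.prems(3) by (auto simp: j_def split: if_splits)
        have "(monomial_of N (i # x @ [i]) :: 'k nTL_elt) = monomial_of N ([] @ (i # u) @ j # v @ [i])"
          by (simp add: x)
        also have "\<dots> = monomial_of N ([] @ (u @ [i]) @ j # v @ [i])"
          using less.prems x j nb by (intro monomial_of_replace monomial_of_commute_word) auto
        also have "\<dots> = monomial_of N ((u @ [i, j]) @ (v @ [i]) @ [])" by simp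
        also have "\<dots> = monomial_of N ((u @ [i, j]) @ (i # v) @ [])"
          using less.prems x j nb
          by (intro monomial_of_replace monomial_of_commute_word[symmetric]) auto
        also have "\<dots> = monomial_of N (u @ [i, j, i] @ v)" by simp
        also have "\<dots> = \<zero>\<^bsub>nTL N\<^esub>"
        proof (rule zero)
          show "(monomial_of N [i, j, i] :: 'k nTL_elt) = \<zero>\<^bsub>nTL N\<^esub>"
            using less.prems(1) monomial_of_braid(1)[of i] monomial_of_braid(2)[of "cpred N i"]
            by (auto simp: j_def)
        qed (use less.prems x j in auto)
        finally show ?thesis .
      qed
    qed
  qed
qed

end

section \<open>Words up to commutation, and their projections to pairs of neighbours\<close>

text \<open>
  The pair \<open>{j - 1, j}\<close> is indexed by \<open>j\<close>, so that the last letter of the projection decides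
  whether \<open>j\<close> is a first index. A letter \<open>i\<close> is seen by the projections \<open>i\<close> and \<open>i + 1\<close>.
\<close>

definition proj :: "nat \<Rightarrow> nat \<Rightarrow> nat list \<Rightarrow> nat list" where
  "proj N j w = filter (\<lambda>x. x = j \<or> x = cpred N j) w"

text \<open>
  In terms of Viennot's heaps of pieces: the words are linear extensions of the same heap.
\<close>

definition same_heap :: "nat \<Rightarrow> nat list \<Rightarrow> nat list \<Rightarrow> bool" where
  "same_heap N u v \<longleftrightarrow> (\<forall>j<N. proj N j u = proj N j v)"

definition alternating :: "nat \<Rightarrow> nat list \<Rightarrow> bool" where
  "alternating N w \<longleftrightarrow> (\<forall>j<N. distinct_adj (proj N j w))"

lemma proj_simps [simp]:
  "proj N j [] = []"
  "proj N j (u @ v) = proj N j u @ proj N j v"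
  by (simp_all add: proj_def)

lemma proj_Cons: "proj N j (i # w) = (if i = j \<or> i = cpred N j then i # proj N j w else proj N j w)"
  by (simp add: proj_def)

lemma set_proj: "set (proj N j w) = set w \<inter> {j, cpred N j}"
  by (auto simp: proj_def)

lemma proj_eq_Nil_iff: "proj N j w = [] \<longleftrightarrow> j \<notin> set w \<and> cpred N j \<notin> set w"
  by (auto simp: proj_def filter_empty_conv)

lemma count_list_filter: "count_list (filter P w) x = (if P x then count_list w x else 0)"
  by (induction w) auto

lemma count_proj:
  "count_list (proj N j w) j = count_list w j"
  "count_list (proj N j w) (cpred N j) = count_list w (cpred N j)"
  by (simp_all add: proj_def count_list_filter)

lemma same_heap_refl [simp]: "same_heap N w w"
  by (simp add: same_heap_def)

lemma same_heap_sym: "same_heap N u v \<Longrightarrow> same_heap N v u"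
  by (simp add: same_heap_def)

lemma same_heap_trans [trans]: "same_heap N u v \<Longrightarrow> same_heap N v w \<Longrightarrow> same_heap N u w"
  by (simp add: same_heap_def)

lemma same_heap_append_cancel: "same_heap N (u @ w) (v @ w) \<longleftrightarrow> same_heap N u v"
  by (simp add: same_heap_def)

lemma same_heap_alternating: "same_heap N u v \<Longrightarrow> alternating N u \<Longrightarrow> alternating N v"
  by (simp add: same_heap_def alternating_def)

lemma same_heap_set:
  assumes "same_heap N u v" "set u \<subseteq> {..<N}" "set v \<subseteq> {..<N}"
  shows "set u = set v"
proof -
  have "i \<in> set u \<longleftrightarrow> i \<in> set v" if "i < N" for i
  proof -
    have "set u \<inter> {i, cpred N i} = set v \<inter> {i, cpred N i}"
      using that assms(1) by (simp add: same_heap_def set_proj[symmetric])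
    then show ?thesis by blast
  qed
  then show ?thesis using assms(2,3) by (meson equalityI lessThan_iff subsetD subsetI)
qed

lemma first_indices_iff_split:
  "j \<in> first_indices N w \<longleftrightarrow> (\<exists>u v. w = u @ j # v \<and> cpred N j \<notin> set v)"
proof
  assume "j \<in> first_indices N w"
  then obtain p where p: "j = w ! p" "p < length w"
    "\<forall>r. p < r \<and> r < length w \<longrightarrow> w ! r \<noteq> cpred N j"
    by (auto simp: first_indices_def cpred_def)
  have "w = take p w @ j # drop (Suc p) w"
    unfolding p(1) by (rule id_take_nth_drop[OF p(2)])
  moreover have "cpred N j \<notin> set (drop (Suc p) w)"
    using p(3) by (auto simp: in_set_conv_nth)
  ultimately show "\<exists>u v. w = u @ j # v \<and> cpred N j \<notin> set v" by blast
next
  assume "\<exists>u v. w = u @ j # v \<and> cpred N j \<notin> set v"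
  then obtain u v where w: "w = u @ j # v" "cpred N j \<notin> set v" by blast
  have no: "w ! r \<noteq> cpred N j" if "length u < r" "r < length w" for r
  proof -
    have "w ! r = v ! (r - Suc (length u))"
      using that w(1) by (simp add: nth_append nth_Cons')
    moreover have "v ! (r - Suc (length u)) \<in> set v"
      using that w(1) by (intro nth_mem) auto
    ultimately show ?thesis using w(2) by metis
  qed
  have p: "w ! length u = j" "length u < length w" by (simp_all add: w(1))
  show "j \<in> first_indices N w"
    unfolding first_indices_def mem_Collect_eq
  proof (intro exI[of _ "length u"] conjI allI impI)
    show "w ! r \<noteq> (w ! length u + N - 1) mod N" if "length u < r \<and> r < length w" for r
      using no that by (simp add: p(1) cpred_def)
  qed (simp_all add: p)
qed

lemma first_indices_subset: "first_indices N w \<subseteq> set w"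
  by (auto simp: first_indices_iff_split)

context
  fixes N :: nat
  assumes N3: "3 \<le> N"
begin

text \<open>
  An occurrence of \<open>j\<close> without \<open>j - 1\<close> to its right exists exactly if the rightmost \<open>j\<close> is
  such an occurrence.
\<close>

lemma first_indices_iff_last:
  assumes "j < N"
  shows "j \<in> first_indices N w \<longleftrightarrow> proj N j w \<noteq> [] \<and> last (proj N j w) = j"
proof
  assume "j \<in> first_indices N w"
  then obtain u v where w: "w = u @ j # v" "cpred N j \<notin> set v"
    by (auto simp: first_indices_iff_split)
  have "\<forall>z\<in>set (proj N j v). z = j" using w(2) by (auto simp: set_proj)
  then have "last (j # proj N j v) = j" by simp
  then show "proj N j w \<noteq> [] \<and> last (proj N j w) = j"
    by (simp add: w(1) proj_Cons)
next
  assume l: "proj N j w \<noteq> [] \<and> last (proj N j w) = j"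
  then have "j \<in> set (proj N j w)" using last_in_set by metis
  then have "j \<in> set w" by (simp add: set_proj)
  then obtain u v where w: "w = u @ j # v" "j \<notin> set v" using split_list_last by metis
  have "cpred N j \<notin> set v"
  proof
    assume "cpred N j \<in> set v"
    then have "proj N j v \<noteq> []" by (simp add: proj_eq_Nil_iff)
    then have "last (proj N j w) \<in> set (proj N j v)" by (simp add: w(1) proj_Cons)
    then have "j \<in> set (proj N j v)" using l by simp
    then show False using w(2) by (simp add: set_proj)
  qed
  then show "j \<in> first_indices N w" using w(1) by (auto simp: first_indices_iff_split)
qed

lemma last_proj_cases:
  assumes "j < N" "proj N j w \<noteq> []"
  shows "last (proj N j w) = (if j \<in> first_indices N w then j else cpred N j)"
proof -
  have "last (proj N j w) \<in> set w \<inter> {j, cpred N j}"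
    unfolding set_proj[symmetric] using assms(2) by (rule last_in_set)
  then show ?thesis using assms first_indices_iff_last[of j w] by auto
qed

lemma same_heap_first_indices:
  assumes "same_heap N u v" "set u \<subseteq> {..<N}" "set v \<subseteq> {..<N}"
  shows "first_indices N u = first_indices N v"
proof -
  have "j \<in> first_indices N u \<longleftrightarrow> j \<in> first_indices N v" if "j < N" for j
    using that assms(1) by (simp add: first_indices_iff_last same_heap_def)
  then show ?thesis using assms(2,3) first_indices_subset by blast
qed

lemma same_heap_move:
  assumes "i < N" "cpred N i \<notin> set x" "csuc N i \<notin> set x"
  shows "same_heap N (u @ i # x @ v) (u @ x @ i # v)"
  unfolding same_heap_def
proof (intro allI impI)
  fix j assume j: "j < N"
  show "proj N j (u @ i # x @ v) = proj N j (u @ x @ i # v)"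
  proof (cases "i = j \<or> i = cpred N j")
    case True
    then have "set (proj N j x) \<subseteq> {i}" using assms j by (auto simp: set_proj N3)
    then have "proj N j x = replicate (length (proj N j x)) i"
      by (intro replicate_eqI) auto
    then have "i # proj N j x = proj N j x @ [i]"
      by (metis replicate_append_same replicate_Suc append_Cons append_Nil)
    then show ?thesis using True by (simp add: proj_Cons)
  qed (simp add: proj_Cons)
qed

text \<open>
  The projection criterion for equality of traces. If the first word starts with \<open>i\<close>, then so
  do those projections of the second word that see \<open>i\<close>. Hence no neighbour of \<open>i\<close> precedes the
  first \<open>i\<close> there, and this letter can be commuted to the front and cancelled.
\<close>

lemma same_heap_monomial_of:
  "same_heap N u v \<Longrightarrow> set u \<subseteq> {..<N} \<Longrightarrow> set v \<subseteq> {..<N} \<Longrightarrow>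
     (monomial_of N u :: 'k::field nTL_elt) = monomial_of N v"
proof (induction u arbitrary: v)
  case Nil
  then show ?case using same_heap_set[OF Nil] by simp
next
  case (Cons i u)
  have i: "i < N" using Cons.prems by simp
  have "i \<in> set v" using same_heap_set[OF Cons.prems] by auto
  then obtain x y where v: "v = x @ i # y" "i \<notin> set x" using split_list_first by metis
  have no: "j \<notin> set x" if "s < N" "i = s \<or> i = cpred N s" "j = s \<or> j = cpred N s" for s j
  proof
    assume jx: "j \<in> set x"
    have eq: "i # proj N s u = proj N s x @ i # proj N s y"
      using Cons.prems(1) that(1,2) unfolding same_heap_def v(1) by (auto simp: proj_Cons)
    have "proj N s x \<noteq> []" using jx that(3) by (auto simp: proj_eq_Nil_iff)
    then have "i \<in> set (proj N s x)" using eq by (cases "proj N s x") auto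
    then show False using v(2) by (simp add: set_proj)
  qed
  have p: "cpred N i \<notin> set x" and s: "csuc N i \<notin> set x"
    using no[of i "cpred N i"] no[of "csuc N i" "csuc N i"] i by (simp_all add: N3)
  have "same_heap N (i # u) (i # x @ y)"
    using same_heap_trans[OF Cons.prems(1)] same_heap_sym[OF same_heap_move[OF i p s, of "[]" y]]
    by (simp add: v(1))
  then have "same_heap N u (x @ y)"
    unfolding same_heap_def by (metis proj_Cons list.inject)
  then have IH: "(monomial_of N u :: 'k nTL_elt) = monomial_of N (x @ y)"
    using Cons.prems v by (intro Cons.IH) auto
  have "(monomial_of N (i # u) :: 'k nTL_elt) = monomial_of N ([i] @ u @ [])" by simp
  also have "\<dots> = monomial_of N ([i] @ (x @ y) @ [])"
    using IH Cons.prems v by (intro monomial_of_replace N3) auto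
  also have "\<dots> = monomial_of N ([] @ (i # x) @ y)" by simp
  also have "\<dots> = monomial_of N ([] @ (x @ [i]) @ y)"
    using Cons.prems v p s by (intro monomial_of_replace monomial_of_commute_word N3) auto
  finally show ?case by (simp add: v)
qed

lemma not_distinct_adj_split: "\<not> distinct_adj xs \<Longrightarrow> \<exists>ys a zs. xs = ys @ a # a # zs"
proof (induction xs)
  case (Cons x xs)
  show ?case
  proof (cases "distinct_adj xs")
    case True
    then have "xs \<noteq> []" "hd xs = x" using Cons.prems by (auto simp: distinct_adj_Cons)
    then have "x # xs = [] @ x # x # tl xs" by (cases xs) auto
    then show ?thesis by blast
  next
    case False
    then obtain ys a zs where "xs = ys @ a # a # zs" using Cons.IH by blast
    then have "x # xs = (x # ys) @ a # a # zs" by simp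
    then show ?thesis by blast
  qed
qed simp

lemma filter_eq_append_split:
  "filter P w = xs @ ys \<Longrightarrow> \<exists>u v. w = u @ v \<and> filter P u = xs \<and> filter P v = ys"
proof (induction xs arbitrary: w)
  case Nil
  then show ?case by (intro exI[of _ "[]"] exI[of _ w]) simp
next
  case (Cons x xs)
  then obtain us vs where w: "w = us @ x # vs" "\<forall>u\<in>set us. \<not> P u" "P x" "filter P vs = xs @ ys"
    by (auto simp: filter_eq_Cons_iff)
  then obtain u v where "vs = u @ v" "filter P u = xs" "filter P v = ys"
    using Cons.IH by blast
  then show ?case using w by (intro exI[of _ "us @ x # u"] exI[of _ v]) simp
qed

text \<open>
  Equal consecutive letters in the projection to \<open>{j - 1, j}\<close> come from two equal letters of the
  word that enclose neither \<open>j - 1\<close> nor \<open>j\<close>, in particular miss a neighbour.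
\<close>

lemma nonzero_alternating:
  assumes "set w \<subseteq> {..<N}" "(monomial_of N w :: 'k::field nTL_elt) \<noteq> \<zero>\<^bsub>nTL N\<^esub>"
  shows "alternating N w"
proof (rule ccontr)
  assume "\<not> alternating N w"
  then obtain j where j: "j < N" "\<not> distinct_adj (proj N j w)" by (auto simp: alternating_def)
  then obtain ys a zs where "proj N j w = ys @ a # a # zs" using not_distinct_adj_split by blast
  then obtain u v where uv: "w = u @ v" "proj N j v = a # a # zs"
    unfolding proj_def using filter_eq_append_split by metis
  then obtain x y where xy: "v = x @ a # y" "a # zs = proj N j y" "a = j \<or> a = cpred N j"
    using filter_eq_ConsD[OF uv(2)[unfolded proj_def]] unfolding proj_def by blast
  then obtain x' y' where xy': "y = x' @ a # y'" "\<forall>z\<in>set x'. \<not> (z = j \<or> z = cpred N j)"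
    using filter_eq_ConsD[OF xy(2)[symmetric, unfolded proj_def]] by blast
  have a: "a < N" using assms(1) by (simp add: uv xy(1))
  have "cpred N a \<notin> set x' \<or> csuc N a \<notin> set x'"
    using xy(3) xy'(2) j(1) by (auto simp: N3)
  then have "(monomial_of N (a # x' @ [a]) :: 'k nTL_elt) = \<zero>\<^bsub>nTL N\<^esub>"
    using assms(1) by (intro monomial_of_repeat_zero N3) (auto simp: uv xy(1) xy'(1))
  from monomial_of_zero_factor[OF N3 this, of "u @ x" y'] show False
    using assms by (simp add: uv(1) xy(1) xy'(1))
qed

text \<open>
  In an alternating list the numbers of the two letters differ by at most one, and the two ends
  decide which number is larger.
\<close>

lemma alternating_count:
  assumes "distinct_adj xs" "set xs \<subseteq> {a, b}" "a \<noteq> b" "xs \<noteq> []"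
  shows "count_list xs a + of_bool (last xs = b) = count_list xs b + of_bool (hd xs = a)"
  using assms
proof (induction xs)
  case (Cons x xs)
  then show ?case by (cases xs) auto
qed simp

lemma alternating_unique:
  assumes "distinct_adj xs" "distinct_adj ys" "set xs \<subseteq> {a, b}" "set ys \<subseteq> {a, b}"
    and "length xs = length ys" "xs \<noteq> [] \<Longrightarrow> last xs = last ys"
  shows "xs = ys"
  using assms(5,1-4,6)
proof (induction xs ys rule: list_induct2)
  case (Cons x xs y ys)
  show ?case
  proof (cases "xs = []")
    case False
    then have ys: "ys \<noteq> []" using Cons.hyps by auto
    have eq: "xs = ys"
      using Cons.prems False ys by (intro Cons.IH) (auto simp: distinct_adj_Cons)
    have "hd ys \<in> {a, b}" using Cons.prems(4) hd_in_set[OF ys] by auto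
    then have "x = y" using Cons.prems False ys unfolding eq by (auto simp: distinct_adj_Cons)
    then show ?thesis using eq by simp
  qed (use Cons in auto)
qed simp

text \<open>
  The first indices fix the last letter of each projection, the counts its length; alternation
  then fixes the projection.
\<close>

lemma alternating_same_heap:
  assumes "alternating N u" "alternating N v"
    and "first_indices N u = first_indices N v"
    and "\<And>j. j < N \<Longrightarrow> count_list u j = count_list v j"
  shows "same_heap N u v"
  unfolding same_heap_def
proof (intro allI impI)
  fix j assume j: "j < N"
  have len: "length (proj N j w) = count_list w j + count_list w (cpred N j)" for w
    by (induction w) (use j N3 in \<open>auto simp: proj_Cons\<close>)
  have l: "length (proj N j u) = length (proj N j v)"
    using assms(4) j N3 by (simp add: len)
  then have "last (proj N j u) = last (proj N j v)" if "proj N j u \<noteq> []"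
    using that assms(3) j by (subst (1 2) last_proj_cases) auto
  then show "proj N j u = proj N j v"
    using assms(1,2) j l
    by (intro alternating_unique[of _ _ j "cpred N j"]) (auto simp: alternating_def set_proj)
qed

end

section \<open>Words acting on configurations\<close>

text \<open>
  Residues are used in place of the positions \<open>1, \<dots>, N\<close>: the letter \<open>i\<close> then moves a particle
  from \<open>i\<close> to \<open>i + 1\<close> modulo \<open>N\<close> also for \<open>i = 0\<close>. Only the residue \<open>0\<close> changes its name, to \<open>N\<close>.
\<close>

definition sites :: "nat \<Rightarrow> nat set \<Rightarrow> nat set" where
  "sites N R = source N ` R"

text \<open>
  Conservation of particles at each site: letters \<open>j - 1\<close> bring particles to site \<open>j\<close> and letters
  \<open>j\<close> take them away. The equation is arranged so that no subtraction of natural numbers occurs.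
\<close>

definition balanced :: "nat \<Rightarrow> nat set \<Rightarrow> nat list \<Rightarrow> nat set \<Rightarrow> bool" where
  "balanced N R w R' \<longleftrightarrow> (\<forall>j<N. of_bool (j \<in> R') + count_list w j =
     of_bool (j \<in> R) + count_list w (cpred N j))"

text \<open>
  The sign comes from sorting the wedge product when a particle passes from \<open>N\<close> to \<open>1\<close>.
\<close>

definition signed_qpower :: "'k::field poly \<Rightarrow> nat \<Rightarrow> bool" where
  "signed_qpower c n \<longleftrightarrow> c = qvar ^ n \<or> c = - (qvar ^ n)"

lemma signed_qpower_nonzero: "signed_qpower c n \<Longrightarrow> c \<noteq> 0"
  by (auto simp: signed_qpower_def qvar_def)

lemma signed_qpower_degree: "signed_qpower c n \<Longrightarrow> degree c = n"
  by (auto simp: signed_qpower_def qvar_def degree_power_eq)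

lemma signed_qpower_step:
  "signed_qpower c n \<Longrightarrow> signed_qpower (c * step_coeff i k) (n + (if i = 0 then 1 else 0))"
proof -
  assume "signed_qpower c n"
  moreover have "(- 1) ^ (k - 1) = (1 :: 'a poly) \<or> (- 1) ^ (k - 1) = (- 1 :: 'a poly)"
    by (cases "even (k - 1)") simp_all
  ultimately show ?thesis
    by (auto simp: signed_qpower_def step_coeff_def mult.commute)
qed

lemma scale_conf_nonzero: "c \<noteq> 0 \<Longrightarrow> scale c (conf I) \<noteq> (\<lambda>_. 0)"
  by (auto simp: scale_def conf_def fun_eq_iff)

lemma scale_conf_eqD:
  assumes "scale c (conf I) = scale d (conf J)" "c \<noteq> 0"
  shows "I = J" "c = d"
proof -
  have "scale c (conf I) I = scale d (conf J) I" using assms(1) by simp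
  then show "I = J" "c = d" using assms(2) by (auto simp: scale_def conf_def split: if_splits)
qed

context
  fixes N :: nat
  assumes N3: "3 \<le> N"
begin

lemma inj_source: "inj_on (source N) {..<N}"
  by (auto simp: inj_on_def source_def split: if_splits)

lemma sites_all: "sites N {..<N} = {1..N}"
proof
  show "sites N {..<N} \<subseteq> {1..N}" by (auto simp: sites_def source_def)
  show "{1..N} \<subseteq> sites N {..<N}"
  proof
    fix x assume x: "x \<in> {1..N}"
    then have "x = source N (x mod N)" by (cases "x = N") (auto simp: source_def)
    then show "x \<in> sites N {..<N}" unfolding sites_def using x by (intro image_eqI[of _ _ "x mod N"]) auto
  qed
qed

lemma sites_subset: "R \<subseteq> {..<N} \<Longrightarrow> sites N R \<subseteq> {1..N}"
  unfolding sites_all[symmetric] sites_def by (rule image_mono)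

lemma sites_surj:
  assumes "J \<subseteq> {1..N}"
  obtains R where "R \<subseteq> {..<N}" "J = sites N R"
  using assms unfolding sites_all[symmetric] sites_def by (meson subset_imageE)

lemma sites_eq_iff: "R \<subseteq> {..<N} \<Longrightarrow> R' \<subseteq> {..<N} \<Longrightarrow> sites N R = sites N R' \<longleftrightarrow> R = R'"
  unfolding sites_def by (rule inj_on_image_eq_iff[OF inj_source])

lemma source_in_sites: "i < N \<Longrightarrow> R \<subseteq> {..<N} \<Longrightarrow> source N i \<in> sites N R \<longleftrightarrow> i \<in> R"
  unfolding sites_def using inj_on_image_mem_iff[OF inj_source] by simp

lemma source_csuc: "i < N \<Longrightarrow> source N (csuc N i) = Suc i"
  by (simp add: source_def csuc_if)

lemma gen_action_sites:
  assumes "i < N" "R \<subseteq> {..<N}"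
  shows "gen_action N i (scale c (conf (sites N R))) =
    (if i \<in> R \<and> csuc N i \<notin> R
     then scale (c * step_coeff i (card (sites N R))) (conf (sites N (insert (csuc N i) (R - {i}))))
     else (\<lambda>_. 0))"
proof -
  have "sites N (insert (csuc N i) (R - {i})) = insert (Suc i) (sites N R - {source N i})"
  proof -
    have "sites N (R - {i}) = sites N R - {source N i}"
      unfolding sites_def using assms inj_on_image_set_diff[OF inj_source, of R "{i}"] by auto
    then show ?thesis using source_csuc[OF assms(1)] by (simp add: sites_def)
  qed
  then show ?thesis
    using source_in_sites[OF assms] source_in_sites[OF csuc_less[OF N3, of i] assms(2)]
      source_csuc[OF assms(1)] assms N3 sites_subset[OF assms(2)]
    by (simp add: gen_action_conf)
qed

lemma balanced_step:
  assumes "i < N" "balanced N R w R'" "i \<in> R'" "csuc N i \<notin> R'"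
  shows "balanced N R (i # w) (insert (csuc N i) (R' - {i}))"
  unfolding balanced_def
proof (intro allI impI)
  fix j assume j: "j < N"
  have b: "of_bool (j \<in> R') + count_list w j = (of_bool (j \<in> R) + count_list w (cpred N j) :: nat)"
    using assms(2) j by (simp add: balanced_def)
  consider "j = i" | "j \<noteq> i" "j = csuc N i" | "j \<noteq> i" "j \<noteq> csuc N i" by blast
  then show "of_bool (j \<in> insert (csuc N i) (R' - {i})) + count_list (i # w) j =
      (of_bool (j \<in> R) + count_list (i # w) (cpred N j) :: nat)"
  proof cases
    case 1
    then show ?thesis using b assms(1,3) by (simp add: N3)
  next
    case 2
    then show ?thesis using b assms(1,4) by (simp add: N3)
  next
    case 3
    then have "i \<noteq> cpred N j" using j N3 by auto
    then show ?thesis using b 3 by simp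
  qed
qed

lemma word_action_sites:
  assumes "set w \<subseteq> {..<N}" "R \<subseteq> {..<N}"
  shows "foldr (gen_action N) w (conf (sites N R)) = (\<lambda>_. 0 :: 'k::field poly) \<or>
    (\<exists>R' c. R' \<subseteq> {..<N} \<and> balanced N R w R' \<and> signed_qpower c (count_list w 0) \<and>
      foldr (gen_action N) w (conf (sites N R)) = scale (c :: 'k poly) (conf (sites N R')))"
  using assms(1)
proof (induction w)
  case Nil
  have "conf (sites N R) = scale (1 :: 'k poly) (conf (sites N R))"
    by (simp add: scale_def)
  moreover have "signed_qpower (1 :: 'k poly) 0" "balanced N R [] R"
    by (simp_all add: signed_qpower_def balanced_def)
  ultimately show ?case using assms(2) by (intro disjI2 exI[of _ R] exI[of _ 1]) simp
next
  case (Cons i w)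
  from Cons.prems have i: "i < N" and w: "set w \<subseteq> {..<N}" by auto
  from Cons.IH[OF w] show ?case
  proof (elim disjE exE conjE)
    assume "foldr (gen_action N) w (conf (sites N R)) = (\<lambda>_. 0 :: 'k poly)"
    then show ?thesis by (simp add: gen_action_zero)
  next
    fix R' and c :: "'k poly"
    assume R': "R' \<subseteq> {..<N}" and b: "balanced N R w R'" and c: "signed_qpower c (count_list w 0)"
      and eq: "foldr (gen_action N) w (conf (sites N R)) = scale c (conf (sites N R'))"
    show ?thesis
    proof (cases "i \<in> R' \<and> csuc N i \<notin> R'")
      case True
      let ?d = "c * step_coeff i (card (sites N R'))" and ?R = "insert (csuc N i) (R' - {i})"
      have 1: "signed_qpower ?d (count_list (i # w) 0)"
        using signed_qpower_step[OF c, of i "card (sites N R')"] by (cases "i = 0") simp_all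
      have 2: "balanced N R (i # w) ?R" using b i True by (intro balanced_step) auto
      have 3: "?R \<subseteq> {..<N}" using R' by (auto simp: N3)
      have 4: "foldr (gen_action N) (i # w) (conf (sites N R)) = scale ?d (conf (sites N ?R))"
        using True by (simp add: eq gen_action_sites[OF i R'])
      show ?thesis using 1 2 3 4 by blast
    qed (auto simp: eq gen_action_sites[OF i R'])
  qed
qed

text \<open>
  If \<open>j\<close> is a first index, then some letter \<open>j\<close> acts before any letter \<open>j - 1\<close> could bring a
  particle to site \<open>j\<close>, so that its particle is there from the beginning.
\<close>

lemma word_action_nonzero_first_indices:
  assumes "set w \<subseteq> {..<N}" "R \<subseteq> {..<N}"
    and "foldr (gen_action N) w (conf (sites N R)) \<noteq> (\<lambda>_. 0 :: 'k::field poly)"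
  shows "first_indices N w \<subseteq> R"
proof
  fix j assume "j \<in> first_indices N w"
  then obtain u v where w: "w = u @ j # v" "cpred N j \<notin> set v"
    by (auto simp: first_indices_iff_split)
  have j: "j < N" and v: "set v \<subseteq> {..<N}" using assms(1) w(1) by auto
  have nz: "gen_action N j (foldr (gen_action N) v (conf (sites N R))) \<noteq> (\<lambda>_. 0 :: 'k poly)"
    using assms(3) unfolding w(1) by (auto simp: word_action_zero)
  then obtain R' and c :: "'k poly" where R': "R' \<subseteq> {..<N}" "balanced N R v R'"
    "foldr (gen_action N) v (conf (sites N R)) = scale c (conf (sites N R'))"
    using word_action_sites[OF v assms(2), where 'k = 'k] by (auto simp: gen_action_zero)
  have "j \<in> R'" using nz by (auto simp: R'(3) gen_action_sites[OF j R'(1)] split: if_splits)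
  moreover have "count_list v (cpred N j) = 0" using w(2) by (simp add: count_list_0_iff)
  moreover have "of_bool (j \<in> R') + count_list v j =
      (of_bool (j \<in> R) + count_list v (cpred N j) :: nat)"
    using R'(2) j by (simp add: balanced_def)
  ultimately show "j \<in> R" by (cases "j \<in> R") auto
qed

text \<open>
  Conservation expresses the occupation of a site \<open>j\<close> by the counts of \<open>j - 1\<close> and \<open>j\<close> in the
  part of the word that has acted; alternation evaluates their difference. For the sites \<open>i\<close> and
  \<open>i + 1\<close> the relevant projections both have \<open>i\<close> as leftmost letter, and this makes site \<open>i\<close>
  occupied and site \<open>i + 1\<close> empty just before that letter acts.
\<close>

lemma alternating_step:
  assumes "alternating N (u @ i # v)" "i < N" "S = first_indices N (u @ i # v)"
    and "balanced N S v R"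
  shows "i \<in> R" "csuc N i \<notin> R"
proof -
  have l: "last (i # proj N j v) = (if j \<in> S then j else cpred N j)"
    if "j < N" "i = j \<or> i = cpred N j" for j
    using last_proj_cases[OF N3 that(1), of "u @ i # v"] that(2)
    by (simp add: proj_Cons assms(3))
  have d: "distinct_adj (i # proj N j v)" if "j < N" "i = j \<or> i = cpred N j" for j
    using assms(1) that by (auto simp: alternating_def proj_Cons distinct_adj_append_iff)
  have "count_list (i # proj N i v) i + of_bool (last (i # proj N i v) = cpred N i) =
      count_list (i # proj N i v) (cpred N i) + of_bool (hd (i # proj N i v) = i)"
    using assms(2) by (intro alternating_count N3 d) (auto simp: set_proj N3)
  then have "count_list v i + of_bool (i \<notin> S) = count_list v (cpred N i)"
    unfolding l[OF assms(2) disjI1[OF refl]] using assms(2)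
    by (auto simp: count_proj N3)
  moreover have "of_bool (i \<in> R) + count_list v i = of_bool (i \<in> S) + count_list v (cpred N i)"
    using assms(2,4) by (simp add: balanced_def)
  ultimately show "i \<in> R" by (cases "i \<in> R"; cases "i \<in> S") auto
  have s: "csuc N i < N" "i = csuc N i \<or> i = cpred N (csuc N i)"
    using assms(2) by (simp_all add: N3)
  have "count_list (i # proj N (csuc N i) v) i +
        of_bool (last (i # proj N (csuc N i) v) = csuc N i) =
      count_list (i # proj N (csuc N i) v) (csuc N i) + of_bool (hd (i # proj N (csuc N i) v) = i)"
    using assms(2) s by (intro alternating_count N3 d) (auto simp: set_proj N3)
  moreover have "count_list (proj N (csuc N i) v) i = count_list v i"
    using count_proj(2)[of N "csuc N i" v] assms(2) by (simp add: N3)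
  ultimately have "count_list v i + of_bool (csuc N i \<in> S) = count_list v (csuc N i)"
    unfolding l[OF s] using assms(2) by (auto simp: count_proj N3)
  moreover have "of_bool (csuc N i \<in> R) + count_list v (csuc N i) =
      of_bool (csuc N i \<in> S) + count_list v i"
    using assms(2,4) s(1) by (auto simp: balanced_def N3)
  ultimately show "csuc N i \<notin> R" by (cases "csuc N i \<in> R"; cases "csuc N i \<in> S") auto
qed

lemma alternating_acts:
  assumes "alternating N w" "set w \<subseteq> {..<N}"
  shows "\<exists>R' c. R' \<subseteq> {..<N} \<and> balanced N (first_indices N w) w R' \<and>
      signed_qpower c (count_list w 0) \<and>
      foldr (gen_action N) w (conf (sites N (first_indices N w))) = scale (c :: 'k::field poly) (conf (sites N R'))"
proof -
  let ?S = "first_indices N w"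
  have S: "?S \<subseteq> {..<N}" using first_indices_subset assms(2) by blast
  have "foldr (gen_action N) v (conf (sites N ?S)) \<noteq> (\<lambda>_. 0 :: 'k poly)" if "w = u @ v" for u v
    using that
  proof (induction v arbitrary: u)
    case Nil
    show ?case by (auto simp: conf_def fun_eq_iff)
  next
    case (Cons i v)
    have i: "i < N" and v: "set v \<subseteq> {..<N}" using assms(2) Cons.prems by auto
    have "foldr (gen_action N) v (conf (sites N ?S)) \<noteq> (\<lambda>_. 0 :: 'k poly)"
      using Cons.IH[of "u @ [i]"] Cons.prems by simp
    then obtain R and c :: "'k poly" where R: "R \<subseteq> {..<N}" "balanced N ?S v R"
      "signed_qpower c (count_list v 0)"
      "foldr (gen_action N) v (conf (sites N ?S)) = scale c (conf (sites N R))"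
      using word_action_sites[OF v S, where 'k = 'k] by blast
    have "i \<in> R" "csuc N i \<notin> R"
      using alternating_step[of u i v ?S R] assms(1) Cons.prems i R(2) by simp_all
    then show ?case
      using signed_qpower_nonzero[OF signed_qpower_step[OF R(3)]]
      by (simp add: R(4) gen_action_sites[OF i R(1)] scale_conf_nonzero)
  qed
  from this[of "[]" w] show ?thesis using word_action_sites[OF assms(2) S, where 'k = 'k] by auto
qed

lemma nTL_action_monomial_of:
  assumes "set w \<subseteq> {..<N}"
  shows "nTL_action N (monomial_of N w :: 'k::field nTL_elt) f = foldr (gen_action N) w f"
  unfolding monomial_of_coset[OF N3 assms]
  by (simp add: nTL_action_coset[OF N3 single_in_carrier[OF N3 assms]] free_action_single)

lemma minimal_input_monomial_of:
  assumes "set w \<subseteq> {..<N}" "(monomial_of N w :: 'k::field nTL_elt) \<noteq> \<zero>\<^bsub>nTL N\<^esub>"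
  shows "minimal_input N (monomial_of N w :: 'k nTL_elt) I \<longleftrightarrow> I = sites N (first_indices N w)"
proof -
  let ?x = "monomial_of N w :: 'k nTL_elt"
  let ?I = "sites N (first_indices N w)"
  have S: "first_indices N w \<subseteq> {..<N}" using first_indices_subset assms(1) by blast
  obtain R and c :: "'k poly" where "signed_qpower c (count_list w 0)"
    "foldr (gen_action N) w (conf ?I) = scale c (conf (sites N R))"
    using alternating_acts[OF nonzero_alternating[OF N3 assms] assms(1), where 'k = 'k] by blast
  then have I: "acts_nontrivially_on N ?x ?I"
    using sites_subset[OF S] scale_conf_nonzero[OF signed_qpower_nonzero]
    by (simp add: acts_nontrivially_on_def nTL_action_monomial_of[OF assms(1)])
  have least: "?I \<subseteq> J \<and> finite J" if J: "acts_nontrivially_on N ?x J" for J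
  proof -
    have sub: "J \<subseteq> {1..N}" using J by (simp add: acts_nontrivially_on_def)
    then obtain R where R: "R \<subseteq> {..<N}" "J = sites N R" by (rule sites_surj)
    have "first_indices N w \<subseteq> R"
      using J R by (intro word_action_nonzero_first_indices[where 'k = 'k] assms(1))
        (auto simp: acts_nontrivially_on_def nTL_action_monomial_of[OF assms(1)])
    then show ?thesis using R(2) finite_subset[OF sub] by (auto simp: sites_def)
  qed
  show ?thesis
  proof
    assume "minimal_input N ?x I"
    then have "acts_nontrivially_on N ?x I" "card I \<le> card ?I"
      using I by (auto simp: minimal_input_def)
    then show "I = ?I" using least[of I] card_seteq by blast
  next
    assume "I = ?I"
    moreover have "card ?I \<le> card J" if "acts_nontrivially_on N ?x J" for J
      using least[OF that] by (intro card_mono) auto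
    ultimately show "minimal_input N ?x I"
      using I by (simp add: minimal_input_def)
  qed
qed

lemma has_output_monomial_of:
  assumes "set w \<subseteq> {..<N}" "(monomial_of N w :: 'k::field nTL_elt) \<noteq> \<zero>\<^bsub>nTL N\<^esub>"
  obtains R where "R \<subseteq> {..<N}" "balanced N (first_indices N w) w R"
    "\<And>I' l. has_output N (monomial_of N w :: 'k nTL_elt) (sites N (first_indices N w)) I' l \<longleftrightarrow>
      I' = sites N R \<and> l = count_list w 0"
proof -
  obtain R and c :: "'k poly" where R: "R \<subseteq> {..<N}" "balanced N (first_indices N w) w R"
    "signed_qpower c (count_list w 0)"
    "foldr (gen_action N) w (conf (sites N (first_indices N w))) = scale c (conf (sites N R))"
    using alternating_acts[OF nonzero_alternating[OF N3 assms] assms(1), where 'k = 'k] by blast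
  have ho: "has_output N (monomial_of N w :: 'k nTL_elt) (sites N (first_indices N w)) I' l \<longleftrightarrow>
      I' \<subseteq> {1..N} \<and> (\<exists>d. signed_qpower d l \<and> scale c (conf (sites N R)) = scale d (conf I'))" for I' l
    by (auto simp: has_output_def nTL_action_monomial_of[OF assms(1)] R(4) signed_qpower_def)
  have "has_output N (monomial_of N w :: 'k nTL_elt) (sites N (first_indices N w)) I' l \<longleftrightarrow>
      I' = sites N R \<and> l = count_list w 0" for I' l
  proof
    assume "has_output N (monomial_of N w :: 'k nTL_elt) (sites N (first_indices N w)) I' l"
    then obtain d where d: "signed_qpower d l" "scale c (conf (sites N R)) = scale d (conf I')"
      by (auto simp: ho)
    from scale_conf_eqD[OF d(2) signed_qpower_nonzero[OF R(3)]]
    have "sites N R = I'" "c = d" .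
    then show "I' = sites N R \<and> l = count_list w 0"
      using signed_qpower_degree[OF R(3)] signed_qpower_degree[OF d(1)] by simp
  next
    assume "I' = sites N R \<and> l = count_list w 0"
    then show "has_output N (monomial_of N w :: 'k nTL_elt) (sites N (first_indices N w)) I' l"
      using R(3) sites_subset[OF R(1)] by (auto simp: ho)
  qed
  with R that show ?thesis by blast
qed

text \<open>
  The power of \<open>q\<close> counts the letters \<open>0\<close>; from there the conservation law gives the number of
  letters \<open>j + 1\<close> from that of the letters \<open>j\<close>.
\<close>

lemma same_action_same_heap:
  assumes "set u \<subseteq> {..<N}" "set w \<subseteq> {..<N}"
    and "(monomial_of N u :: 'k::field nTL_elt) \<noteq> \<zero>\<^bsub>nTL N\<^esub>"
    and "(monomial_of N w :: 'k nTL_elt) \<noteq> \<zero>\<^bsub>nTL N\<^esub>"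
    and "minimal_input N (monomial_of N u :: 'k nTL_elt) I" "has_output N (monomial_of N u :: 'k nTL_elt) I I' l"
    and "minimal_input N (monomial_of N w :: 'k nTL_elt) I" "has_output N (monomial_of N w :: 'k nTL_elt) I I' l"
  shows "same_heap N u w"
proof -
  have I: "I = sites N (first_indices N u)" "I = sites N (first_indices N w)"
    using assms by (simp_all add: minimal_input_monomial_of)
  have "first_indices N u \<subseteq> {..<N}" "first_indices N w \<subseteq> {..<N}"
    using first_indices_subset assms(1,2) by blast+
  then have S: "first_indices N u = first_indices N w" using I sites_eq_iff by metis
  obtain R where R: "R \<subseteq> {..<N}" "balanced N (first_indices N u) u R"
    "I' = sites N R" "l = count_list u 0"
    using has_output_monomial_of[OF assms(1,3)] assms(6) I(1) by metis
  obtain R' where R': "R' \<subseteq> {..<N}" "balanced N (first_indices N w) w R'"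
    "I' = sites N R'" "l = count_list w 0"
    using has_output_monomial_of[OF assms(2,4)] assms(8) I(2) by metis
  have "R = R'" using R(1,3) R'(1,3) sites_eq_iff by metis
  have "count_list u j = count_list w j" if "j < N" for j
    using that
  proof (induction j)
    case 0
    show ?case using R(4) R'(4) by simp
  next
    case (Suc j)
    then have "cpred N (Suc j) = j" by (simp add: cpred_if)
    then show ?case
      using Suc R(2) R'(2) \<open>R = R'\<close> S unfolding balanced_def
      by (metis Suc_lessD add_left_cancel)
  qed
  then show ?thesis
    using S by (intro alternating_same_heap N3 nonzero_alternating[where 'k = 'k] assms(1-4))
qed

end

section \<open>Rows and normal forms\<close>

definition entries :: "nat option list \<Rightarrow> nat list" where
  "entries r = List.map_filter (\<lambda>x. x) r"

text \<open>
  The word spelled by the rows, where the head of the list is the rightmost block and acts first.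
\<close>

definition block_word :: "nat option list list \<Rightarrow> nat list" where
  "block_word A = entries (concat (rev A))"

definition succ_entry :: "nat \<Rightarrow> nat option \<Rightarrow> nat option \<Rightarrow> bool" where
  "succ_entry N x y \<longleftrightarrow> y = None \<or> (\<exists>j. x = Some j \<and> y = Some (csuc N j))"

primrec valid_rows :: "nat \<Rightarrow> nat option list \<Rightarrow> nat option list list \<Rightarrow> bool" where
  "valid_rows N r [] \<longleftrightarrow> True"
| "valid_rows N r (r' # A) \<longleftrightarrow> list_all2 (succ_entry N) r r' \<and> valid_rows N r' A"

definition trimmed :: "nat option list list \<Rightarrow> bool" where
  "trimmed A \<longleftrightarrow> (A \<noteq> [] \<longrightarrow> entries (last A) \<noteq> [])"

text \<open>
  In an ordered row a letter \<open>b\<close> never stands to the right of \<open>b + 1\<close>. So the letter \<open>b\<close>, if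
  present, is to the left of \<open>b + 1\<close>, and all entries of the row are first indices of it. This is
  what remains of the cyclic order of the listing; unlike that order it is inherited by the
  next row without reference to a starting point.
\<close>

definition ordered :: "nat \<Rightarrow> nat list \<Rightarrow> bool" where
  "ordered N L \<longleftrightarrow> distinct L \<and> sorted_wrt (\<lambda>a b. a \<noteq> csuc N b) L"

lemma entries_simps [simp]:
  "entries [] = []"
  "entries (None # r) = entries r"
  "entries (Some j # r) = j # entries r"
  by (simp_all add: entries_def)

lemma entries_append [simp]: "entries (r @ r') = entries r @ entries r'"
  by (simp add: entries_def List.map_filter_def)

lemma entries_map_Some [simp]: "entries (map Some L) = L"
  by (induction L) simp_all

lemma set_entries: "j \<in> set (entries r) \<longleftrightarrow> Some j \<in> set r"
  by (induction r) (auto simp: entries_def split: option.splits)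

lemma entries_eq_Nil_iff: "entries r = [] \<longleftrightarrow> (\<forall>x\<in>set r. x = None)"
  by (induction r) (auto simp: entries_def split: option.splits)

lemma block_word_simps [simp]:
  "block_word [] = []"
  "block_word (r # A) = block_word A @ entries r"
  by (simp_all add: block_word_def)

lemma set_block_word: "set (block_word A) = (\<Union>r\<in>set A. set (entries r))"
  by (induction A) auto

lemma trimmed_Cons: "trimmed (r # A) \<Longrightarrow> trimmed A"
  by (auto simp: trimmed_def split: if_splits)

lemma trimmed_Nil: "trimmed A \<Longrightarrow> block_word A = [] \<Longrightarrow> A = []"
proof (rule ccontr)
  assume t: "trimmed A" and b: "block_word A = []" and "A \<noteq> []"
  then have "last A \<in> set A" "entries (last A) \<noteq> []" by (auto simp: trimmed_def)
  then have "set (block_word A) \<noteq> {}" unfolding set_block_word by fastforce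
  then show False using b by simp
qed

lemma ordered_Cons:
  "ordered N (j # L) \<longleftrightarrow> j \<notin> set L \<and> (\<forall>b\<in>set L. j \<noteq> csuc N b) \<and> ordered N L"
  by (auto simp: ordered_def)

lemma ordered_snoc:
  "ordered N (L @ [j]) \<longleftrightarrow> j \<notin> set L \<and> csuc N j \<notin> set L \<and> ordered N L"
  by (auto simp: ordered_def sorted_wrt_append)

lemma first_indices_appendD:
  assumes "j \<in> first_indices N (x @ y)"
  shows "j \<in> first_indices N y \<or> j \<in> first_indices N x \<and> cpred N j \<notin> set y"
proof -
  obtain u v where uv: "x @ y = u @ j # v" "cpred N j \<notin> set v"
    using assms by (auto simp: first_indices_iff_split)
  then consider us where "x = u @ us" "us @ y = j # v" | us where "x @ us = u" "y = us @ j # v"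
    by (auto simp: append_eq_append_conv2)
  then show ?thesis
  proof cases
    case 1
    show ?thesis
    proof (cases us)
      case Nil
      then have "y = [] @ j # v" using 1 by simp
      then show ?thesis using uv(2) unfolding first_indices_iff_split by blast
    next
      case (Cons k us')
      then have "x = u @ j # us'" "v = us' @ y" using 1 by auto
      then show ?thesis using uv(2) unfolding first_indices_iff_split by auto
    qed
  next
    case 2
    then show ?thesis using uv(2) unfolding first_indices_iff_split by blast
  qed
qed

context
  fixes N :: nat
  assumes N3: "3 \<le> N"
begin

lemma succ_row_entries:
  assumes "list_all2 (succ_entry N) r r'" "set (entries r) \<subseteq> {..<N}"
  shows "set (entries r') \<subseteq> csuc N ` set (entries r)"
    and "ordered N (entries r) \<Longrightarrow> ordered N (entries r')"
proof -
  have "set (entries r') \<subseteq> csuc N ` set (entries r) \<and>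
      (ordered N (entries r) \<longrightarrow> ordered N (entries r'))"
    using assms
  proof (induction rule: list_all2_induct)
    case Nil
    show ?case by simp
  next
    case (Cons x r y r')
    show ?case
    proof (cases y)
      case None
      then show ?thesis using Cons by (cases x) (auto simp: ordered_Cons)
    next
      case (Some k)
      then obtain j where j: "x = Some j" "k = csuc N j"
        using Cons.hyps by (auto simp: succ_entry_def)
      have IH: "set (entries r') \<subseteq> csuc N ` set (entries r)"
        "ordered N (entries r) \<longrightarrow> ordered N (entries r')"
        using Cons j(1) by auto
      have rN: "b < N" if "b \<in> set (entries r)" for b
        using Cons.prems j(1) that by auto
      have jN: "j < N" using Cons.prems j(1) by simp
      have "ordered N (k # entries r')" if o: "ordered N (j # entries r)"
        unfolding ordered_Cons
      proof (intro conjI ballI)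
        have "csuc N j \<notin> csuc N ` set (entries r)"
          using o rN jN csuc_eq_iff[OF N3] by (auto simp: ordered_Cons)
        then show "k \<notin> set (entries r')" using IH(1) j(2) by blast
        show "k \<noteq> csuc N b" if b: "b \<in> set (entries r')" for b
        proof
          obtain b' where b': "b = csuc N b'" "b' \<in> set (entries r)" using b IH(1) by blast
          assume "k = csuc N b"
          then have "j = b" using csuc_eq_iff[OF N3, of j b] jN b'(1) j(2) by (simp add: N3)
          then show False using o b' by (auto simp: ordered_Cons)
        qed
      qed (use o IH(2) in \<open>simp add: ordered_Cons\<close>)
      then show ?thesis using Some j IH(1) by auto
    qed
  qed
  then show "set (entries r') \<subseteq> csuc N ` set (entries r)"
    "ordered N (entries r) \<Longrightarrow> ordered N (entries r')" by blast+
qed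

lemma succ_row_range:
  "list_all2 (succ_entry N) r r' \<Longrightarrow> set (entries r) \<subseteq> {..<N} \<Longrightarrow> set (entries r') \<subseteq> {..<N}"
  using succ_row_entries(1)[of r r'] by (force simp: N3)

lemma valid_rows_range:
  "valid_rows N r A \<Longrightarrow> set (entries r) \<subseteq> {..<N} \<Longrightarrow> set (block_word A) \<subseteq> {..<N}"
  by (induction A arbitrary: r) (auto dest: succ_row_range)

text \<open>
  Since the entries of a row are distinct, the set of entries of its successor row tells which
  columns continue.
\<close>

lemma succ_row_unique:
  assumes "list_all2 (succ_entry N) r a" "list_all2 (succ_entry N) r b"
    and "distinct (entries r)" "set (entries r) \<subseteq> {..<N}"
    and "set (entries a) = set (entries b)"
  shows "a = b"
  using assms
proof (induction r arbitrary: a b)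
  case (Cons x r)
  obtain y a' where a: "a = y # a'" "succ_entry N x y" "list_all2 (succ_entry N) r a'"
    using Cons.prems(1) by (auto simp: list_all2_Cons1)
  obtain z b' where b: "b = z # b'" "succ_entry N x z" "list_all2 (succ_entry N) r b'"
    using Cons.prems(2) by (auto simp: list_all2_Cons1)
  have r: "distinct (entries r)" "set (entries r) \<subseteq> {..<N}"
    using Cons.prems(3,4) by (cases x; simp)+
  have new: "csuc N j \<notin> set (entries c)"
    if c: "c = a' \<or> c = b'" and j: "x = Some j" for j c
  proof
    assume "csuc N j \<in> set (entries c)"
    moreover have "list_all2 (succ_entry N) r c" using c a(3) b(3) by blast
    ultimately obtain i where i: "i \<in> set (entries r)" "csuc N j = csuc N i"
      using succ_row_entries(1)[OF _ r(2)] by blast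
    then have "i < N" "j < N" using r(2) Cons.prems(4) j by auto
    then have "j = i" using i(2) csuc_eq_iff[OF N3] by blast
    then show False using i(1) j Cons.prems(3) by simp
  qed
  show ?case
  proof (cases y; cases z)
    assume "y = None" "z = None"
    then show ?thesis using Cons.IH[OF a(3) b(3) r] Cons.prems(5) a(1) b(1) by simp
  next
    fix k assume *: "y = None" "z = Some k"
    then obtain j where "x = Some j" "k = csuc N j" using b(2) by (auto simp: succ_entry_def)
    then show ?thesis using new[of a' j] Cons.prems(5) a(1) b(1) * by auto
  next
    fix k assume *: "y = Some k" "z = None"
    then obtain j where "x = Some j" "k = csuc N j" using a(2) by (auto simp: succ_entry_def)
    then show ?thesis using new[of b' j] Cons.prems(5) a(1) b(1) * by auto
  next
    fix k k' assume *: "y = Some k" "z = Some k'"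
    then obtain j where j: "x = Some j" "k = csuc N j" "k' = csuc N j"
      using a(2) b(2) by (auto simp: succ_entry_def)
    have "set (entries a') = set (entries b')"
      using new[of a' j] new[of b' j] Cons.prems(5) a(1) b(1) * j
      by (metis Diff_insert_absorb entries_simps(3) list.simps(15))
    then show ?thesis using Cons.IH[OF a(3) b(3) r] a(1) b(1) * j by simp
  qed
qed simp

text \<open>
  An entry \<open>j\<close> of a later row has the entry \<open>j - 1\<close> of its column in the preceding row, to its
  right; an entry of the rightmost row has no \<open>j - 1\<close> to its right because the row is ordered.
\<close>

lemma first_indices_block_word:
  assumes "valid_rows N r A" "set (entries r) \<subseteq> {..<N}" "ordered N (entries r)"
  shows "first_indices N (block_word (r # A)) = set (entries r)"
proof
  show "first_indices N (block_word (r # A)) \<subseteq> set (entries r)"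
    using assms(1,2)
  proof (induction A arbitrary: r)
    case Nil
    show ?case using first_indices_subset by simp
  next
    case (Cons r' A)
    then have r': "list_all2 (succ_entry N) r r'" and A: "valid_rows N r' A" by simp_all
    have "first_indices N (block_word (r' # A)) \<subseteq> csuc N ` set (entries r)"
      using Cons.IH[OF A succ_row_range[OF r' Cons.prems(2)]]
        succ_row_entries(1)[OF r' Cons.prems(2)] by blast
    moreover have "cpred N (csuc N j) \<in> set (entries r)" if "j \<in> set (entries r)" for j
      using that Cons.prems(2) by (auto simp: N3)
    ultimately have "j \<in> set (entries r)" if "j \<in> first_indices N (block_word (r' # A) @ entries r)" for j
      using first_indices_appendD[OF that] first_indices_subset by blast
    then show ?case by auto
  qed
  show "set (entries r) \<subseteq> first_indices N (block_word (r # A))"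
  proof
    fix j assume "j \<in> set (entries r)"
    then obtain x y where xy: "entries r = x @ j # y" by (auto dest: split_list)
    have "cpred N j \<notin> set y"
    proof
      assume y: "cpred N j \<in> set y"
      have "j < N" using assms(2) xy by simp
      then have eq: "csuc N (cpred N j) = j" by (simp add: N3)
      have "\<forall>b\<in>set y. j \<noteq> csuc N b"
        using assms(3) unfolding ordered_def xy by (simp add: sorted_wrt_append)
      from bspec[OF this y] show False unfolding eq by simp
    qed
    moreover have "block_word (r # A) = (block_word A @ x) @ j # y" by (simp add: xy)
    ultimately show "j \<in> first_indices N (block_word (r # A))"
      unfolding first_indices_iff_split by blast
  qed
qed

lemma rows_unique:
  assumes "valid_rows N r A" "valid_rows N r B" "trimmed A" "trimmed B"
    and "set (entries r) \<subseteq> {..<N}" "ordered N (entries r)"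
    and "same_heap N (block_word A) (block_word B)"
  shows "A = B"
  using assms
proof (induction A arbitrary: r B)
  case Nil
  have "set (block_word B) = {}"
    using same_heap_set[OF Nil.prems(7)] valid_rows_range[OF Nil.prems(2,5)] by simp
  then show ?case using trimmed_Nil[OF Nil.prems(4)] by simp
next
  case (Cons a A)
  have range: "set (block_word (a # A)) \<subseteq> {..<N}" "set (block_word B) \<subseteq> {..<N}"
    by (rule valid_rows_range[OF Cons.prems(1,5)], rule valid_rows_range[OF Cons.prems(2,5)])
  have "B \<noteq> []"
  proof
    assume "B = []"
    then have "set (block_word (a # A)) = {}"
      using same_heap_set[OF Cons.prems(7) range] by simp
    then show False using trimmed_Nil[OF Cons.prems(3)] by simp
  qed
  then obtain b B' where B: "B = b # B'" by (cases B) auto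
  have a: "list_all2 (succ_entry N) r a" "valid_rows N a A" using Cons.prems(1) by simp_all
  have b: "list_all2 (succ_entry N) r b" "valid_rows N b B'" using Cons.prems(2) by (simp_all add: B)
  note range_a = succ_row_range[OF a(1) Cons.prems(5)]
  note range_b = succ_row_range[OF b(1) Cons.prems(5)]
  note ord_a = succ_row_entries(2)[OF a(1) Cons.prems(5,6)]
  note ord_b = succ_row_entries(2)[OF b(1) Cons.prems(5,6)]
  have "set (entries a) = set (entries b)"
    using same_heap_first_indices[OF N3 Cons.prems(7) range]
    unfolding B first_indices_block_word[OF a(2) range_a ord_a]
      first_indices_block_word[OF b(2) range_b ord_b] .
  then have eq: "a = b"
    using succ_row_unique[OF a(1) b(1) _ Cons.prems(5)] Cons.prems(6) by (simp add: ordered_def)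
  have "same_heap N (block_word A) (block_word B')"
    using Cons.prems(7) by (simp add: B eq same_heap_append_cancel)
  then have "A = B'"
    using Cons.IH[OF a(2) _ _ _ range_a ord_a] b(2) trimmed_Cons Cons.prems(3,4) B eq by blast
  then show ?case by (simp add: B eq)
qed

end

context
  fixes N :: nat
  assumes N3: "3 \<le> N"
begin

text \<open>
  The letters are split off from the end of \<open>L\<close>. For the last one, \<open>t\<close>, the neighbour \<open>t - 1\<close>
  is not to the right of the rightmost \<open>t\<close> since \<open>t\<close> is a first index. The neighbour \<open>t + 1\<close> is
  not there either, since otherwise \<open>t + 1\<close> would be a first index, hence an element of \<open>L\<close> to the
  left of \<open>t\<close>, against the order. For the induction the last two hypotheses have to stand in for
  equality of \<open>L\<close> with the first indices, because the removal of \<open>t\<close> may turn \<open>t + 1\<close> into a new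
  first index.
\<close>

lemma peel_letters:
  assumes "alternating N w" "set w \<subseteq> {..<N}" "ordered N L"
    and "set L \<subseteq> first_indices N w"
    and "\<And>s. s \<in> set L \<Longrightarrow> csuc N s \<in> first_indices N w \<Longrightarrow> csuc N s \<in> set L"
  shows "\<exists>w'. set w' \<subseteq> {..<N} \<and> length w = length w' + length L \<and> same_heap N w (w' @ L)"
  using assms
proof (induction L arbitrary: w rule: rev_induct)
  case Nil
  then show ?case by auto
next
  case (snoc t L)
  have tf: "t \<in> first_indices N w" using snoc.prems(4) by simp
  then obtain x y where xy: "w = x @ t # y" "cpred N t \<notin> set y"
    by (auto simp: first_indices_iff_split)
  have t: "t < N" using snoc.prems(2) by (simp add: xy)
  have o: "t \<notin> set L" "csuc N t \<notin> set L" "ordered N L"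
    using snoc.prems(3) by (simp_all add: ordered_snoc)
  have stf: "csuc N t \<notin> first_indices N w"
    using snoc.prems(5)[of t] o(2) t by (auto simp: N3)
  have y: "csuc N t \<notin> set y"
  proof
    assume "csuc N t \<in> set y"
    then obtain y1 y2 where y: "y = y1 @ csuc N t # y2" "csuc N t \<notin> set y2"
      using split_list_last by metis
    have "t \<in> set y2"
    proof (rule ccontr)
      assume "t \<notin> set y2"
      then have "w = (x @ t # y1) @ csuc N t # y2 \<and> cpred N (csuc N t) \<notin> set y2"
        using t by (simp add: xy y N3)
      then show False using stf unfolding first_indices_iff_split by blast
    qed
    \<comment> \<open>two letters \<open>t\<close> with no \<open>t - 1\<close> in between\<close>
    then have "t \<in> set (proj N t y)" "set (proj N t y) \<subseteq> {t}"
      using xy(2) y(1) by (auto simp: set_proj)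
    then have "proj N t y \<noteq> [] \<and> hd (proj N t y) = t" by (cases "proj N t y") auto
    then have "\<not> distinct_adj (proj N t w)"
      by (auto simp: xy(1) proj_Cons distinct_adj_append_iff distinct_adj_Cons)
    then show False using snoc.prems(1) t by (simp add: alternating_def)
  qed
  let ?v = "x @ y"
  have same: "same_heap N w (?v @ [t])"
    using same_heap_move[OF N3 t xy(2) y, of x "[]"] by (simp add: xy(1))
  have v: "set ?v \<subseteq> {..<N}" using snoc.prems(2) by (auto simp: xy(1))
  have alt: "alternating N (?v @ [t])" by (rule same_heap_alternating[OF same snoc.prems(1)])
  then have altv: "alternating N ?v" by (auto simp: alternating_def distinct_adj_append_iff)
  have fi: "first_indices N w = first_indices N (?v @ [t])"
    using v t by (intro same_heap_first_indices[OF N3 same snoc.prems(2)]) auto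
  have away: "s \<in> first_indices N ?v \<longleftrightarrow> s \<in> first_indices N w"
    if "s < N" "s \<noteq> t" "s \<noteq> csuc N t" for s
  proof -
    have "t \<noteq> cpred N s" using that by (auto simp: N3)
    then show ?thesis using that unfolding fi by (simp add: first_indices_iff_last N3 proj_Cons)
  qed
  have tv: "t \<notin> first_indices N ?v"
  proof
    assume "t \<in> first_indices N ?v"
    then have "proj N t ?v \<noteq> []" "last (proj N t ?v) = t"
      using first_indices_iff_last[OF N3 t] by blast+
    moreover have "distinct_adj (proj N t (?v @ [t]))"
      using alt t by (simp only: alternating_def)
    then have "distinct_adj (proj N t ?v @ [t])" by (simp add: proj_Cons)
    ultimately show False by (simp add: distinct_adj_append_iff del: proj_simps)
  qed
  have Lv: "set L \<subseteq> first_indices N ?v"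
  proof
    fix s assume s: "s \<in> set L"
    then have "s \<in> first_indices N w" using snoc.prems(4) by auto
    moreover from this have "s < N" using first_indices_subset snoc.prems(2) by blast
    ultimately show "s \<in> first_indices N ?v" using away[of s] o(1,2) s by metis
  qed
  have closed: "csuc N s \<in> set L" if s: "s \<in> set L" "csuc N s \<in> first_indices N ?v" for s
  proof -
    have sN: "s < N" using s(1) Lv first_indices_subset v by blast
    have "csuc N s \<noteq> t" using s(2) tv by auto
    moreover have "csuc N s \<noteq> csuc N t" using csuc_eq_iff[OF N3 sN t] o(1) s(1) by auto
    ultimately have "csuc N s \<in> first_indices N w" using away[of "csuc N s"] s(2) by (simp add: N3)
    then show ?thesis using snoc.prems(5)[of s] s(1) \<open>csuc N s \<noteq> t\<close> by simp
  qed
  obtain w' where w': "set w' \<subseteq> {..<N}" "length ?v = length w' + length L" "same_heap N ?v (w' @ L)"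
    using snoc.IH[OF altv v o(3) Lv closed] by blast
  have "same_heap N w (w' @ L @ [t])"
    using same_heap_trans[OF same] w'(3) same_heap_append_cancel[of N ?v "[t]" "w' @ L"] by simp
  then show ?case using w'(1,2) by (intro exI[of _ w']) (simp add: xy(1))
qed

text \<open>
  A first index \<open>j\<close> of the remaining word needs \<open>j - 1\<close> in the row that was split off: without it, the
  projection of the whole word to \<open>{j - 1, j}\<close> either repeats \<open>j\<close> or makes \<open>j\<close> a first index
  that is missing from the row.
\<close>

lemma peel_row:
  assumes "alternating N w" "set w \<subseteq> {..<N}" "ordered N L" "set L = first_indices N w"
  obtains w' where "set w' \<subseteq> {..<N}" "length w = length w' + length L" "same_heap N w (w' @ L)"
    "alternating N w'" "first_indices N w' \<subseteq> csuc N ` set L"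
proof -
  obtain w' where w': "set w' \<subseteq> {..<N}" "length w = length w' + length L" "same_heap N w (w' @ L)"
    using peel_letters[OF assms(1-3)] assms(4) by auto
  have alt: "alternating N (w' @ L)" by (rule same_heap_alternating[OF w'(3) assms(1)])
  have LN: "set L \<subseteq> {..<N}" using assms(2,4) first_indices_subset by blast
  have fi: "first_indices N (w' @ L) = set L"
    using same_heap_first_indices[OF N3 w'(3) assms(2)] w'(1) LN assms(4) by simp
  have "j \<in> csuc N ` set L" if j: "j \<in> first_indices N w'" for j
  proof (rule ccontr)
    assume "j \<notin> csuc N ` set L"
    have jN: "j < N" using j first_indices_subset w'(1) by blast
    then have p: "cpred N j \<notin> set L"
      using \<open>j \<notin> csuc N ` set L\<close> by (metis csuc_cpred[OF N3] imageI)
    then have sub: "set (proj N j L) \<subseteq> {j}" by (auto simp: set_proj)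
    have l: "proj N j w' \<noteq> []" "last (proj N j w') = j"
      using j first_indices_iff_last[OF N3 jN] by auto
    show False
    proof (cases "proj N j L = []")
      case True
      then have "j \<in> first_indices N (w' @ L)" using l first_indices_iff_last[OF N3 jN] by simp
      then show False using fi True by (simp add: proj_eq_Nil_iff)
    next
      case False
      then have "hd (proj N j L) = j" using sub hd_in_set by blast
      then show False using alt jN l False
        by (auto simp: alternating_def distinct_adj_append_iff)
    qed
  qed
  moreover have "alternating N w'" using alt by (auto simp: alternating_def distinct_adj_append_iff)
  ultimately show ?thesis using w' that by blast
qed

text \<open>
  The next row keeps those columns of \<open>r\<close> whose successor is a first index. It is not all \<open>1\<close> for
  a nonempty word, as the last letter is a first index; so the last row is never trivial.
\<close>

lemma rows_exist:
  assumes "alternating N w" "set w \<subseteq> {..<N}" "ordered N (entries r)" "set (entries r) \<subseteq> {..<N}"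
    and "first_indices N w \<subseteq> csuc N ` set (entries r)"
  shows "\<exists>A. valid_rows N r A \<and> trimmed A \<and> same_heap N w (block_word A)"
  using assms
proof (induction "length w" arbitrary: w r rule: less_induct)
  case less
  show ?case
  proof (cases "w = []")
    case True
    then show ?thesis by (intro exI[of _ "[]"]) (simp add: trimmed_def)
  next
    case False
    let ?S = "first_indices N w"
    let ?next = "\<lambda>x. case x of None \<Rightarrow> None | Some j \<Rightarrow> if csuc N j \<in> ?S then Some (csuc N j) else None"
    define r' where "r' = map ?next r"
    have succ: "list_all2 (succ_entry N) r r'"
      unfolding r'_def list_all2_conv_all_nth by (auto simp: succ_entry_def split: option.splits)
    have set_r': "set (entries r') = ?S"
    proof
      show "set (entries r') \<subseteq> ?S"
        by (auto simp: r'_def set_entries split: option.splits if_splits)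
      show "?S \<subseteq> set (entries r')"
      proof
        fix j assume j: "j \<in> ?S"
        then obtain i where i: "j = csuc N i" "Some i \<in> set r"
          using less.prems(5) by (auto simp: set_entries)
        have "?next (Some i) \<in> set r'" unfolding r'_def set_map by (rule imageI[OF i(2)])
        then show "j \<in> set (entries r')" using i(1) j by (simp add: set_entries)
      qed
    qed
    note ord = succ_row_entries(2)[OF N3 succ less.prems(4,3)]
    note range = succ_row_range[OF N3 succ less.prems(4)]
    have "last w \<in> ?S"
      using False append_butlast_last_id[of w] first_indices_iff_split[of "last w" N w]
      by (metis empty_iff empty_set)
    then have ne: "entries r' \<noteq> []" using set_r' by auto
    obtain w' where w': "set w' \<subseteq> {..<N}" "length w = length w' + length (entries r')"
      "same_heap N w (w' @ entries r')" "alternating N w'"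
      "first_indices N w' \<subseteq> csuc N ` set (entries r')"
      using peel_row[OF less.prems(1,2) ord set_r'] by blast
    have "length w' < length w" using w'(2) ne by simp
    from less.hyps[OF this w'(4,1) ord range w'(5)] obtain A where
      A: "valid_rows N r' A" "trimmed A" "same_heap N w' (block_word A)" by blast
    have "same_heap N w (block_word (r' # A))"
      using same_heap_trans[OF w'(3)] A(3) by (simp add: same_heap_append_cancel)
    moreover have "trimmed (r' # A)" using A(2) ne by (simp add: trimmed_def)
    ultimately show ?thesis using succ A(1) by (intro exI[of _ "r' # A"]) simp
  qed
qed

text \<open>
  If \<open>t\<close> is the last letter of a word, then every \<open>t + 1\<close> in it has \<open>t\<close> to its right.
\<close>

lemma first_indices_proper:
  assumes "set w \<subseteq> {..<N}"
  shows "first_indices N w \<subset> {..<N}"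
proof -
  have sub: "first_indices N w \<subseteq> {..<N}" using assms first_indices_subset by blast
  have "\<exists>j<N. j \<notin> first_indices N w"
  proof (cases "w = []")
    case True
    then show ?thesis using N3 by (intro exI[of _ 0]) (simp add: first_indices_def)
  next
    case False
    have t: "last w < N" using assms False last_in_set by blast
    have "last (proj N (csuc N (last w)) w) = last w"
      by (subst (1 2) append_butlast_last_id[OF False, symmetric]) (use t N3 in \<open>simp add: proj_Cons\<close>)
    then have "csuc N (last w) \<notin> first_indices N w"
      using t N3 by (simp add: first_indices_iff_last)
    then show ?thesis using N3 by (intro exI[of _ "csuc N (last w)"]) simp
  qed
  then show ?thesis using sub by auto
qed

text \<open>
  A nonempty set closed under successors on the circle is everything, so the set over which
  the maximum is taken is nonempty.
\<close>

lemma cyclic_start: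
  assumes "S \<noteq> {}" "S \<subset> {..<N}"
  shows "cyclic_start N S < N" "cyclic_start N S \<notin> S"
proof -
  let ?M = "{i. i < N \<and> i \<notin> S \<and> (i + N - 1) mod N \<in> S}"
  have "?M \<noteq> {}"
  proof
    assume empty: "?M = {}"
    have step: "csuc N i \<in> S" if "i \<in> S" for i
    proof (rule ccontr)
      assume "csuc N i \<notin> S"
      moreover have "(csuc N i + N - 1) mod N = i"
        using cpred_csuc[OF N3, of i] assms(2) that by (auto simp: cpred_def)
      ultimately have "csuc N i \<in> ?M" using that by (simp add: N3)
      then show False using empty by blast
    qed
    obtain s where s: "s \<in> S" "s < N" using assms by blast
    have "(s + t) mod N \<in> S" for t
    proof (induction t)
      case (Suc t)
      then show ?case using step[OF Suc] by (simp add: csuc_def mod_Suc_eq)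
    qed (use s in simp)
    moreover have "(s + (i + N - s)) mod N = i" if "i < N" for i using s that by simp
    ultimately have "{..<N} \<subseteq> S" by (metis lessThan_iff subsetI)
    then show False using assms(2) by blast
  qed
  moreover have "finite ?M" by simp
  ultimately have "Max ?M \<in> ?M" by (rule Max_in[rotated])
  then show "cyclic_start N S < N" "cyclic_start N S \<notin> S" by (simp_all add: cyclic_start_def)
qed

lemma shift_mod_inj: "t < N \<Longrightarrow> t' < N \<Longrightarrow> (c + t) mod N = (c + t') mod N \<Longrightarrow> t = t'"
  using cong_add_lcancel_nat[of c t t' N] cong_less_modulus_unique_nat[of t t' N]
  by (simp add: cong_def)

lemma set_cyclic_listing:
  assumes "S \<subseteq> {..<N}"
  shows "set (cyclic_listing N S) = S"
proof -
  let ?f = "\<lambda>t. (cyclic_start N S + t) mod N"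
  have "inj_on ?f {..<N}" by (auto intro: inj_onI shift_mod_inj)
  moreover have "?f ` {..<N} \<subseteq> {..<N}" using N3 by auto
  ultimately have "?f ` {..<N} = {..<N}" by (intro endo_inj_surj) auto
  then show ?thesis using assms by (auto simp: cyclic_listing_def atLeast0LessThan)
qed

text \<open>
  Along the listing, \<open>b + 1\<close> could precede \<open>b\<close> only if \<open>b + 1\<close> were the starting point, which does
  not belong to \<open>S\<close>.
\<close>

lemma ordered_cyclic_listing:
  assumes "S \<subset> {..<N}"
  shows "ordered N (cyclic_listing N S)"
proof (cases "S = {}")
  case True
  then show ?thesis by (simp add: cyclic_listing_def ordered_def)
next
  case False
  let ?c = "cyclic_start N S"
  let ?f = "\<lambda>t. (?c + t) mod N"
  let ?R = "\<lambda>a b. a \<in> S \<longrightarrow> a \<noteq> csuc N b"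
  have R: "?R (?f t) (?f t')" if t: "t < t'" "t' < N" for t t'
  proof (intro impI notI)
    assume S: "?f t \<in> S" and "?f t = csuc N (?f t')"
    then have eq: "(?c + t) mod N = (?c + Suc t') mod N" by (simp add: csuc_def mod_Suc_eq)
    show False
    proof (cases "Suc t' = N")
      case True
      then have "t = 0" using shift_mod_inj[of t 0 ?c] eq t by simp
      then show False using S cyclic_start[OF False assms] by simp
    next
      case False
      then show False using shift_mod_inj[of t "Suc t'" ?c] eq t by simp
    qed
  qed
  have "sorted_wrt ?R (map ?f [0..<N])"
    unfolding sorted_wrt_map sorted_wrt_iff_nth_less using R by simp
  then have "sorted_wrt ?R (cyclic_listing N S)"
    unfolding cyclic_listing_def by (rule sorted_wrt_filter)
  then have "sorted_wrt (\<lambda>a b. a \<noteq> csuc N b) (cyclic_listing N S)"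
    by (rule sorted_wrt_mono_rel[rotated]) (auto simp: cyclic_listing_def)
  moreover have "distinct (cyclic_listing N S)"
    unfolding cyclic_listing_def
    by (intro distinct_filter) (auto simp: distinct_map intro!: inj_onI dest: shift_mod_inj)
  ultimately show ?thesis by (simp add: ordered_def)
qed

lemma valid_rows_iff_nth:
  "valid_rows N r A \<longleftrightarrow> (\<forall>row\<in>set A. length row = length r) \<and>
     (\<forall>n<length A. \<forall>l<length r. (r # A) ! Suc n ! l \<in>
        (case (r # A) ! n ! l of None \<Rightarrow> {None} | Some j \<Rightarrow> {None, Some (Suc j mod N)}))"
proof (induction A arbitrary: r)
  case (Cons r' A)
  have entry: "y \<in> (case x of None \<Rightarrow> {None} | Some j \<Rightarrow> {None, Some (Suc j mod N)}) \<longleftrightarrow> succ_entry N x y"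
    for x y by (auto simp: succ_entry_def csuc_def split: option.splits)
  show ?case
    by (auto simp: Cons.IH entry list_all2_conv_all_nth All_less_Suc2)
qed simp

lemma is_normal_form_iff:
  "is_normal_form N js A \<longleftrightarrow>
     (\<exists>S. S \<subset> {..<N} \<and> js = cyclic_listing N S) \<and> valid_rows N (map Some js) A \<and> trimmed A"
proof -
  have "trimmed A \<longleftrightarrow> (A \<noteq> [] \<longrightarrow> (\<exists>x\<in>set (last A). x \<noteq> None))"
    by (auto simp: trimmed_def entries_eq_Nil_iff)
  then show ?thesis
    unfolding is_normal_form_def valid_rows_iff_nth all_rows_def by simp
qed

lemma factors_product:
  "set (entries r) \<subseteq> {..<N} \<Longrightarrow>
     list_product (nTL N) (map (factor N) r) = (monomial_of N (entries r) :: 'k::field nTL_elt)"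
proof (induction r)
  case (Cons x r)
  interpret ring "nTL N :: 'k nTL_elt ring" by (rule ring_nTL[OF N3])
  show ?case
    using Cons monomial_of_closed[OF N3, of "entries r", where 'k = 'k]
    by (cases x) (auto simp: list_product_def monomial_of_def factor_def)
qed (simp add: monomial_of_def)

lemma normal_form_value_block_word:
  assumes "set js \<subseteq> {..<N}" "valid_rows N (map Some js) A"
  shows "(normal_form_value N js A :: 'k::field nTL_elt) = monomial_of N (block_word (map Some js # A))"
  unfolding normal_form_value_def all_rows_def
  using assms valid_rows_range[OF N3 assms(2)]
  by (subst factors_product) (auto simp: block_word_def)

end

section \<open>Normal forms of monomials\<close>

context
  fixes N :: nat
  assumes N3: "3 \<le> N"
begin

text \<open>
  The projections of a nonzero word depend only on its monomial, because the action does.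
\<close>

lemma equal_monomials_same_heap:
  assumes "set u \<subseteq> {..<N}" "set w \<subseteq> {..<N}"
    and "(monomial_of N u :: 'k::field nTL_elt) = monomial_of N w"
    and "(monomial_of N w :: 'k nTL_elt) \<noteq> \<zero>\<^bsub>nTL N\<^esub>"
  shows "same_heap N u w"
proof -
  let ?I = "sites N (first_indices N w)"
  obtain R where "has_output N (monomial_of N w :: 'k nTL_elt) ?I (sites N R) (count_list w 0)"
    using has_output_monomial_of[OF N3 assms(2,4)] by metis
  moreover have "minimal_input N (monomial_of N w :: 'k nTL_elt) ?I"
    using minimal_input_monomial_of[OF N3 assms(2,4)] by simp
  ultimately show ?thesis
    using assms by (intro same_action_same_heap[OF N3, where 'k = 'k]) simp_all
qed

lemma normal_form_exists:
  assumes "set w \<subseteq> {..<N}" "(monomial_of N w :: 'k::field nTL_elt) \<noteq> \<zero>\<^bsub>nTL N\<^esub>"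
    and "js = cyclic_listing N (first_indices N w)"
  shows "\<exists>A. is_normal_form N js A \<and> (normal_form_value N js A :: 'k nTL_elt) = monomial_of N w"
proof -
  have S: "first_indices N w \<subset> {..<N}" by (rule first_indices_proper[OF N3 assms(1)])
  have js: "set js = first_indices N w" "ordered N js" "set js \<subseteq> {..<N}"
    using S set_cyclic_listing[OF N3] ordered_cyclic_listing[OF N3] by (auto simp: assms(3))
  obtain w' where w': "set w' \<subseteq> {..<N}" "length w = length w' + length js"
    "same_heap N w (w' @ js)" "alternating N w'" "first_indices N w' \<subseteq> csuc N ` set js"
    by (rule peel_row[OF N3 nonzero_alternating[OF N3 assms(1,2)] assms(1) js(2,1)])
  obtain A where A: "valid_rows N (map Some js) A" "trimmed A" "same_heap N w' (block_word A)"
    using rows_exist[OF N3 w'(4,1), of "map Some js"] js(2,3) w'(5) by auto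
  have same: "same_heap N (block_word (map Some js # A)) w"
    using same_heap_trans[OF w'(3)] A(3) by (simp add: same_heap_append_cancel same_heap_sym)
  have "set (block_word (map Some js # A)) \<subseteq> {..<N}"
    using valid_rows_range[OF N3 A(1)] js(3) by simp
  then have "(normal_form_value N js A :: 'k nTL_elt) = monomial_of N w"
    unfolding normal_form_value_block_word[OF N3 js(3) A(1)]
    using same_heap_monomial_of[OF N3 same _ assms(1)] by blast
  moreover have "is_normal_form N js A"
    using is_normal_form_iff[OF N3] S A(1,2) assms(3) by blast
  ultimately show ?thesis by blast
qed

lemma normal_form_unique:
  assumes "(normal_form_value N js A :: 'k::field nTL_elt) = normal_form_value N js' A'"
    and "(normal_form_value N js A :: 'k nTL_elt) \<noteq> \<zero>\<^bsub>nTL N\<^esub>"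
    and "is_normal_form N js A" "is_normal_form N js' A'"
  shows "js = js' \<and> A = A'"
proof -
  let ?w = "\<lambda>js A. block_word (map Some js # A)"
  have nf: "\<exists>S. S = set ks \<and> ks = cyclic_listing N S" "ordered N ks" "set ks \<subseteq> {..<N}"
    "valid_rows N (map Some ks) B" "trimmed B" "set (?w ks B) \<subseteq> {..<N}"
    "(normal_form_value N ks B :: 'k nTL_elt) = monomial_of N (?w ks B)"
    "first_indices N (?w ks B) = set ks"
    if B: "is_normal_form N ks B" for ks B
  proof -
    obtain S where S: "S \<subset> {..<N}" "ks = cyclic_listing N S"
      and v: "valid_rows N (map Some ks) B" and t: "trimmed B"
      using B is_normal_form_iff[OF N3] by blast
    have ks: "set ks = S" using set_cyclic_listing[OF N3] S by auto
    have o: "ordered N ks" and r: "set ks \<subseteq> {..<N}"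
      using S ks ordered_cyclic_listing[OF N3 S(1)] by auto
    show "\<exists>S. S = set ks \<and> ks = cyclic_listing N S" "ordered N ks" "set ks \<subseteq> {..<N}"
      "valid_rows N (map Some ks) B" "trimmed B"
      using S ks o r v t by auto
    show "set (?w ks B) \<subseteq> {..<N}" using valid_rows_range[OF N3 v] r by simp
    show "(normal_form_value N ks B :: 'k nTL_elt) = monomial_of N (?w ks B)"
      by (rule normal_form_value_block_word[OF N3 r v])
    show "first_indices N (?w ks B) = set ks"
      using first_indices_block_word[OF N3 v] r o by simp
  qed
  have same: "same_heap N (?w js A) (?w js' A')"
    using assms(1,2) nf(7)[OF assms(3)] nf(7)[OF assms(4)]
    by (intro equal_monomials_same_heap[where 'k = 'k] nf(6)[OF assms(3)] nf(6)[OF assms(4)]) simp_all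
  have "set js = set js'"
    using same_heap_first_indices[OF N3 same nf(6)[OF assms(3)] nf(6)[OF assms(4)]]
    by (simp only: nf(8)[OF assms(3)] nf(8)[OF assms(4)])
  then have js: "js = js'" using nf(1)[OF assms(3)] nf(1)[OF assms(4)] by metis
  have "same_heap N (block_word A) (block_word A')"
    using same by (simp add: js same_heap_append_cancel)
  then have "A = A'"
    using nf(2-5)[OF assms(3)] nf(4,5)[OF assms(4)]
    by (intro rows_unique[OF N3, of "map Some js"]) (simp_all add: js)
  then show ?thesis using js by simp
qed

end

theorem mainTheorem1:
  fixes N :: nat
  assumes "N \<ge> 3"
  shows
    "(\<forall>ws. set ws \<subseteq> {..<N} \<and> (monomial_of N ws :: 'k::field nTL_elt) \<noteq> \<zero>\<^bsub>nTL N\<^esub> \<longrightarrow>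
        (\<exists>js A. is_normal_form N js A \<and>
           (normal_form_value N js A :: 'k nTL_elt) = monomial_of N ws \<and>
           js = cyclic_listing N (first_indices N ws) \<and>
           (\<forall>js' A'. is_normal_form N js' A' \<and>
              (normal_form_value N js' A' :: 'k nTL_elt) = monomial_of N ws \<longrightarrow>
              js' = js \<and> A' = A)))
     \<and> (\<forall>x \<in> (nonzero_monomials N :: 'k nTL_elt set).
          (\<exists>!I. minimal_input N x I) \<and>
          (\<forall>I. minimal_input N x I \<longrightarrow> (\<exists>I' l. has_output N x I I' l)))
     \<and> (\<forall>x \<in> (nonzero_monomials N :: 'k nTL_elt set). \<forall>y \<in> nonzero_monomials N. \<forall>I I' l.
          minimal_input N x I \<and> has_output N x I I' l \<and>
          minimal_input N y I \<and> has_output N y I I' l \<longrightarrow> x = y)"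
proof -
  have forms: "\<exists>js A. is_normal_form N js A \<and>
      (normal_form_value N js A :: 'k nTL_elt) = monomial_of N ws \<and>
      js = cyclic_listing N (first_indices N ws) \<and>
      (\<forall>js' A'. is_normal_form N js' A' \<and>
         (normal_form_value N js' A' :: 'k nTL_elt) = monomial_of N ws \<longrightarrow> js' = js \<and> A' = A)"
    if ws: "set ws \<subseteq> {..<N}" "(monomial_of N ws :: 'k nTL_elt) \<noteq> \<zero>\<^bsub>nTL N\<^esub>" for ws
  proof -
    let ?js = "cyclic_listing N (first_indices N ws)"
    obtain A where A: "is_normal_form N ?js A"
      "(normal_form_value N ?js A :: 'k nTL_elt) = monomial_of N ws"
      using normal_form_exists[OF assms ws refl] by blast
    have "js' = ?js \<and> A' = A" if "is_normal_form N js' A'"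
      "(normal_form_value N js' A' :: 'k nTL_elt) = monomial_of N ws" for js' A'
      using normal_form_unique[OF assms, of js' A' ?js A, where 'k = 'k] that A ws(2) by simp
    with A show ?thesis by blast
  qed
  have monomial: "\<exists>w. set w \<subseteq> {..<N} \<and> x = monomial_of N w \<and>
      (monomial_of N w :: 'k nTL_elt) \<noteq> \<zero>\<^bsub>nTL N\<^esub>"
    if "x \<in> nonzero_monomials N" for x :: "'k nTL_elt"
    using that unfolding nonzero_monomials_def by blast
  have inputs: "(\<exists>!I. minimal_input N x I) \<and>
      (\<forall>I. minimal_input N x I \<longrightarrow> (\<exists>I' l. has_output N x I I' l))"
    if x: "x \<in> nonzero_monomials N" for x :: "'k nTL_elt"
  proof -
    obtain w where w: "set w \<subseteq> {..<N}" "x = monomial_of N w"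
      "(monomial_of N w :: 'k nTL_elt) \<noteq> \<zero>\<^bsub>nTL N\<^esub>"
      using monomial[OF x] by blast
    obtain R where "has_output N x (sites N (first_indices N w)) (sites N R) (count_list w 0)"
      using has_output_monomial_of[OF assms w(1,3)] w(2) by metis
    then show ?thesis
      unfolding w(2) minimal_input_monomial_of[OF assms w(1,3)] by blast
  qed
  have determined: "x = y"
    if x: "x \<in> nonzero_monomials N" and y: "y \<in> nonzero_monomials N"
      and d: "minimal_input N x I" "has_output N x I I' l" "minimal_input N y I" "has_output N y I I' l"
    for x y :: "'k nTL_elt" and I I' l
  proof -
    obtain u where u: "set u \<subseteq> {..<N}" "x = monomial_of N u"
      "(monomial_of N u :: 'k nTL_elt) \<noteq> \<zero>\<^bsub>nTL N\<^esub>"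
      using monomial[OF x] by blast
    obtain w where w: "set w \<subseteq> {..<N}" "y = monomial_of N w"
      "(monomial_of N w :: 'k nTL_elt) \<noteq> \<zero>\<^bsub>nTL N\<^esub>"
      using monomial[OF y] by blast
    have "same_heap N u w"
      using d unfolding u(2) w(2) by (rule same_action_same_heap[OF assms u(1) w(1) u(3) w(3)])
    then show ?thesis
      unfolding u(2) w(2) by (rule same_heap_monomial_of[OF assms _ u(1) w(1)])
  qed
  show ?thesis
    by (rule conjI[OF _ conjI]) (use forms in presburger, use inputs in simp, metis determined)
qed

end
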